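(* The set of all products $r(A_1:j_1)\,r(A_2:j_2)\cdots r(A_s:j_s)$ (with $s\ge 0$), where $A_1,\dots,A_s\subseteq\{1,\dots,n\}$, $1\le j_i\le |A_i|$ for all $i$, and, for all $2\le i\le s$, either $|A_i|\ne |A_{i-1}|-j_{i-1}$ or $A_i\not\subseteq A_{i-1}$, is a basis of $Q_n$ as a $k$-vector space.
   Context: Let $k$ be a field and $n\ge 1$. $Q_n$ is the associative unital $k$-algebra with generators $z_{A,i}$, for $A\subseteq\{1,\dots,n\}$ and $i\in\{1,\dots,n\}\setminus A$ ($A$ may be empty), and defining relations $$z_{A\cup\{i\},j}+z_{A,i}=z_{A\cup\{j\},i}+z_{A,j},\qquad z_{A\cup\{i\},j}\,z_{A,i}=z_{A\cup\{j\},i}\,z_{A,j}$$ for all $A$ and all distinct $i,j\notin A$. For $A=\{c_1,\dots,c_u\}\subseteq\{1,\dots,n\}$ put $r(A)=z_{\emptyset,c_1}+z_{\{c_1\},c_2}+\dots+z_{\{c_1,\dots,c_{u-1}\},c_u}\in Q_n$; by the first relations this does not depend on the chosen ordering of $A$. Also $r(\emptyset)=0$. For nonempty $A=\{a_1,\dots,a_u\}$ written with $a_1>a_2>\dots>a_u$ and $1\le j\le u$, put $$r(A:j)=r(A)\,r(A\setminus\{a_1\})\,r(A\setminus\{a_1,a_2\})\cdots r(A\setminus\{a_1,\dots,a_{j-1}\}).$$ The empty product ($s=0$) is $1$. *)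

theory Defs
  imports "HOL-Library.Poly_Mapping" "HOL-Algebra.QuotRing" "Jordan_Normal_Form.VS_Connect"
begin

section \<open>Free associative algebras\<close>

text \<open>Words form a monoid under concatenation, so that the convolution product on
  finitely supported functions on words is the product of noncommutative polynomials.\<close>

instantiation list :: (type) monoid_add
begin
definition zero_list :: "'a list" where "zero_list = []"
definition plus_list :: "'a list \<Rightarrow> 'a list \<Rightarrow> 'a list" where "plus_list = append"
instance by standard (simp_all add: zero_list_def plus_list_def)
end

definition free_algebra :: "'g set \<Rightarrow> ('k::field, 'g list \<Rightarrow>\<^sub>0 'k) module" where
  "free_algebra X = \<lparr>carrier = {p. Poly_Mapping.keys p \<subseteq> lists X},
     mult = (*), one = 1, zero = 0, add = (+), smult = (\<lambda>c. Poly_Mapping.map ((*) c))\<rparr>"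

definition free_gen :: "'g \<Rightarrow> ('g list \<Rightarrow>\<^sub>0 'k::field)" where
  "free_gen x = Poly_Mapping.single [x] 1"

text \<open>The quotient ring of an algebra by an ideal, with the induced scalar multiplication on
  cosets (defined in the same style as \<^const>\<open>rcoset_mult\<close>).\<close>

definition quotient_algebra :: "('k, 'a) module \<Rightarrow> 'a set \<Rightarrow> ('k, 'a set) module" where
  "quotient_algebra R I = ring.extend (R Quot I)
     (module.fields (\<lambda>c X. \<Union>x\<in>X. I +>\<^bsub>R\<^esub> (c \<odot>\<^bsub>R\<^esub> x)))"


section \<open>The algebra $Q_n$\<close>

definition gens :: "nat \<Rightarrow> (nat set \<times> nat) set" where
  "gens n = {(A, i). A \<subseteq> {1..n} \<and> i \<in> {1..n} - A}"

abbreviation free_Q :: "nat \<Rightarrow> ('k::field, (nat set \<times> nat) list \<Rightarrow>\<^sub>0 'k) module" where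
  "free_Q n \<equiv> free_algebra (gens n)"

definition relators :: "nat \<Rightarrow> ((nat set \<times> nat) list \<Rightarrow>\<^sub>0 'k::field) set" where
  "relators n =
     {(free_gen (insert i A, j) + free_gen (A, i)) - (free_gen (insert j A, i) + free_gen (A, j))
        | A i j. A \<subseteq> {1..n} \<and> i \<in> {1..n} - A \<and> j \<in> {1..n} - A \<and> i \<noteq> j} \<union>
     {free_gen (insert i A, j) * free_gen (A, i) - free_gen (insert j A, i) * free_gen (A, j)
        | A i j. A \<subseteq> {1..n} \<and> i \<in> {1..n} - A \<and> j \<in> {1..n} - A \<and> i \<noteq> j}"

definition rel_ideal :: "nat \<Rightarrow> ((nat set \<times> nat) list \<Rightarrow>\<^sub>0 'k::field) set" where
  "rel_ideal n = Idl\<^bsub>free_Q n\<^esub> (relators n)"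

definition Q_alg :: "nat \<Rightarrow> ('k::field, ((nat set \<times> nat) list \<Rightarrow>\<^sub>0 'k) set) module" where
  "Q_alg n = quotient_algebra (free_Q n) (rel_ideal n)"

definition z_elt :: "nat \<Rightarrow> nat set \<Rightarrow> nat \<Rightarrow> ((nat set \<times> nat) list \<Rightarrow>\<^sub>0 'k::field) set" where
  "z_elt n A i = rel_ideal n +>\<^bsub>free_Q n\<^esub> free_gen (A, i)"


section \<open>The elements $r(A)$ and $r(A:j)$\<close>

text \<open>For an ordering \<open>cs\<close> of \<open>A\<close>, \<open>r_ord n cs\<close> is
  $z_{\emptyset,c_1}+z_{\{c_1\},c_2}+\dots+z_{\{c_1,\dots,c_{u-1}\},c_u}$.
  It is independent of the ordering, see \<open>r_elt_eq_r_ord\<close> below;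
  \<open>r_elt n A\<close> uses the increasing one.\<close>

definition r_ord :: "nat \<Rightarrow> nat list \<Rightarrow> ((nat set \<times> nat) list \<Rightarrow>\<^sub>0 'k::field) set" where
  "r_ord n cs = (\<Oplus>\<^bsub>Q_alg n\<^esub>l\<in>{..<length cs}. z_elt n (set (take l cs)) (cs ! l))"

definition r_elt :: "nat \<Rightarrow> nat set \<Rightarrow> ((nat set \<times> nat) list \<Rightarrow>\<^sub>0 'k::field) set" where
  "r_elt n A = r_ord n (sorted_list_of_set A)"

text \<open>With $a_1>\dots>a_u$ the elements of \<open>A\<close>, \<open>drop_largest l A\<close> is
  $A\setminus\{a_1,\dots,a_l\}$.\<close>

definition drop_largest :: "nat \<Rightarrow> nat set \<Rightarrow> nat set" where
  "drop_largest l A = A - set (take l (rev (sorted_list_of_set A)))"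

definition Q_prod :: "nat \<Rightarrow> ((nat set \<times> nat) list \<Rightarrow>\<^sub>0 'k::field) set list \<Rightarrow>
    ((nat set \<times> nat) list \<Rightarrow>\<^sub>0 'k) set" where
  "Q_prod n xs = foldr (\<otimes>\<^bsub>Q_alg n\<^esub>) xs \<one>\<^bsub>Q_alg n\<^esub>"

definition r_desc :: "nat \<Rightarrow> nat set \<Rightarrow> nat \<Rightarrow> ((nat set \<times> nat) list \<Rightarrow>\<^sub>0 'k::field) set" where
  "r_desc n A j = Q_prod n (map (\<lambda>l. r_elt n (drop_largest l A)) [0..<j])"

text \<open>The truncated subtraction below is harmless, since \<open>j \<le> card A\<close> for all entries.\<close>

definition admissible :: "nat \<Rightarrow> (nat set \<times> nat) list \<Rightarrow> bool" where
  "admissible n ps \<longleftrightarrow>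
     (\<forall>(A, j) \<in> set ps. A \<subseteq> {1..n} \<and> 1 \<le> j \<and> j \<le> card A) \<and>
     (\<forall>i. Suc i < length ps \<longrightarrow>
        card (fst (ps ! Suc i)) \<noteq> card (fst (ps ! i)) - snd (ps ! i) \<or>
        \<not> fst (ps ! Suc i) \<subseteq> fst (ps ! i))"

definition basis_products :: "nat \<Rightarrow> ((nat set \<times> nat) list \<Rightarrow>\<^sub>0 'k::field) set set" where
  "basis_products n = {Q_prod n (map (\<lambda>(A, j). r_desc n A j) ps) | ps. admissible n ps}"


section \<open>Well-formedness of the definitions\<close>

lemma free_algebra_simps [simp]:
  "carrier (free_algebra X) = {p. Poly_Mapping.keys p \<subseteq> lists X}"
  "mult (free_algebra X) = (*)" "one (free_algebra X) = 1"
  "zero (free_algebra X) = 0" "add (free_algebra X) = (+)"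
  "smult (free_algebra X) = (\<lambda>c. Poly_Mapping.map ((*) c))"
  by (simp_all add: free_algebra_def)

lemma map_mult_conv: "Poly_Mapping.map ((*) c) p = Poly_Mapping.single [] c * p"
  for p :: "'g list \<Rightarrow>\<^sub>0 'k::field"
proof -
  have "Poly_Mapping.map ((*) c) (Poly_Mapping.single w a) =
      Poly_Mapping.single [] c * Poly_Mapping.single w a" for w :: "'g list" and a
    by (rule poly_mapping_eqI)
      (simp add: mult_single plus_list_def map.rep_eq lookup_single when_def)
  moreover have "Poly_Mapping.map ((*) c) (p + q) =
      Poly_Mapping.map ((*) c) p + Poly_Mapping.map ((*) c) q" for p q :: "'g list \<Rightarrow>\<^sub>0 'k"
    by (rule poly_mapping_eqI)
      (auto simp: map.rep_eq lookup_add when_def distrib_left simp flip: distrib_left)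
  moreover have "Poly_Mapping.update w a p = Poly_Mapping.single w a + p"
    if "w \<notin> Poly_Mapping.keys p" for w a and p :: "'g list \<Rightarrow>\<^sub>0 'k"
    using that by (intro poly_mapping_eqI)
      (auto simp: lookup_update lookup_add lookup_single not_in_keys_iff_lookup_eq_zero)
  moreover have "Poly_Mapping.map ((*) c) 0 = (0 :: 'g list \<Rightarrow>\<^sub>0 'k)"
    by (rule poly_mapping_eqI) (simp add: map.rep_eq)
  ultimately show ?thesis
    by (induction p rule: Poly_Mapping.update_induct) (simp_all add: distrib_left)
qed

lemma keys_mult_lists:
  fixes p q :: "'g list \<Rightarrow>\<^sub>0 'k::field"
  assumes "Poly_Mapping.keys p \<subseteq> lists X" "Poly_Mapping.keys q \<subseteq> lists X"
  shows "Poly_Mapping.keys (p * q) \<subseteq> lists X"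
proof -
  have "Poly_Mapping.keys (p * q) \<subseteq> {a + b | a b. a \<in> Poly_Mapping.keys p \<and> b \<in> Poly_Mapping.keys q}"
    by (rule keys_mult)
  also have "\<dots> \<subseteq> lists X"
    using assms[THEN subsetD] by (fastforce simp: plus_list_def simp del: in_lists_conv_set)
  finally show ?thesis .
qed

lemma keys_add_lists:
  fixes p q :: "'g list \<Rightarrow>\<^sub>0 'k::field"
  assumes "Poly_Mapping.keys p \<subseteq> lists X" "Poly_Mapping.keys q \<subseteq> lists X"
  shows "Poly_Mapping.keys (p + q) \<subseteq> lists X"
  using assms Poly_Mapping.keys_add[of p q] by blast

lemma ring_free_algebra: "ring (free_algebra X :: ('k::field, 'g list \<Rightarrow>\<^sub>0 'k) module)"
proof (rule ringI)
  show "abelian_group (free_algebra X :: ('k, 'g list \<Rightarrow>\<^sub>0 'k) module)"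
  proof (rule abelian_groupI; simp add: keys_add_lists add.assoc add.commute)
    fix p :: "'g list \<Rightarrow>\<^sub>0 'k" assume "Poly_Mapping.keys p \<subseteq> lists X"
    then show "\<exists>q. Poly_Mapping.keys q \<subseteq> lists X \<and> p + q = 0"
      by (intro exI[of _ "- p"]) simp
  qed
  show "Group.monoid (free_algebra X :: ('k, 'g list \<Rightarrow>\<^sub>0 'k) module)"
    by (rule monoidI) (auto simp: keys_mult_lists mult.assoc zero_list_def)
qed (auto simp: distrib_left distrib_right)

lemma free_gen_closed: "(A, i) \<in> gens n \<Longrightarrow> free_gen (A, i) \<in> carrier (free_Q n :: ('k::field, _) module)"
  by (auto simp: free_gen_def)

lemma relators_closed: "relators n \<subseteq> carrier (free_Q n :: ('k::field, _) module)"
proof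
  fix p :: "(nat set \<times> nat) list \<Rightarrow>\<^sub>0 'k"
  assume "p \<in> relators n"
  then obtain A i j where A: "A \<subseteq> {1..n}" "i \<in> {1..n} - A" "j \<in> {1..n} - A" "i \<noteq> j"
    and p: "p = (free_gen (insert i A, j) + free_gen (A, i)) - (free_gen (insert j A, i) + free_gen (A, j)) \<or>
      p = free_gen (insert i A, j) * free_gen (A, i) - free_gen (insert j A, i) * free_gen (A, j)"
    unfolding relators_def by blast
  have "(insert i A, j) \<in> gens n" "(A, i) \<in> gens n" "(insert j A, i) \<in> gens n" "(A, j) \<in> gens n"
    using A by (auto simp: gens_def)
  note g = this[THEN free_gen_closed[where 'k = 'k]]
  have minus: "Poly_Mapping.keys (a - b) \<subseteq> lists (gens n)"
    if "Poly_Mapping.keys a \<subseteq> lists (gens n)" "Poly_Mapping.keys b \<subseteq> lists (gens n)"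
    for a b :: "(nat set \<times> nat) list \<Rightarrow>\<^sub>0 'k"
    using keys_add_lists[of a "gens n" "- b"] that by simp
  show "p \<in> carrier (free_Q n)"
    using p g by (elim disjE) (simp_all only: free_algebra_simps mem_Collect_eq,
      (intro minus keys_add_lists keys_mult_lists; assumption)+)
qed

lemma rel_ideal: "ideal (rel_ideal n) (free_Q n :: ('k::field, _) module)"
  unfolding rel_ideal_def by (rule ring.genideal_ideal[OF ring_free_algebra relators_closed])

lemma quotient_algebra_simps:
  "carrier (quotient_algebra R I) = carrier (R Quot I)"
  "mult (quotient_algebra R I) = mult (R Quot I)"
  "one (quotient_algebra R I) = one (R Quot I)"
  "zero (quotient_algebra R I) = zero (R Quot I)"
  "add (quotient_algebra R I) = add (R Quot I)"
  "smult (quotient_algebra R I) = (\<lambda>c X. \<Union>x\<in>X. I +>\<^bsub>R\<^esub> (c \<odot>\<^bsub>R\<^esub> x))"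
  by (simp_all add: quotient_algebra_def ring.defs module.defs)


context
  fixes X :: "'g set" and I :: "('g list \<Rightarrow>\<^sub>0 'k::field) set"
  assumes I: "ideal I (free_algebra X :: ('k, 'g list \<Rightarrow>\<^sub>0 'k) module)"
begin

interpretation ideal I "free_algebra X :: ('k, 'g list \<Rightarrow>\<^sub>0 'k) module"
  by (rule I)

lemma smult_coset:
  assumes "x \<in> carrier (free_algebra X)"
  shows "c \<odot>\<^bsub>quotient_algebra (free_algebra X) I\<^esub> (I +>\<^bsub>free_algebra X\<^esub> x) =
    I +>\<^bsub>free_algebra X\<^esub> (c \<odot>\<^bsub>free_algebra X\<^esub> x)"
proof -
  let ?F = "free_algebra X :: ('k, 'g list \<Rightarrow>\<^sub>0 'k) module"
  have s: "Poly_Mapping.single [] c \<in> carrier ?F"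
    by auto
  have "I +>\<^bsub>?F\<^esub> (c \<odot>\<^bsub>?F\<^esub> y) = I +>\<^bsub>?F\<^esub> (c \<odot>\<^bsub>?F\<^esub> x)" if y: "y \<in> I +>\<^bsub>?F\<^esub> x" for y
  proof -
    from y obtain h where h: "h \<in> I" "y = h + x"
      by (auto simp: a_r_coset_def')
    have hI: "Poly_Mapping.single [] c * h \<in> I"
      using I_l_closed[OF h(1) s] by simp
    have x: "Poly_Mapping.single [] c * x \<in> carrier ?F"
      using m_closed[OF s assms] by simp
    have "c \<odot>\<^bsub>?F\<^esub> y = (Poly_Mapping.single [] c * h) \<oplus>\<^bsub>?F\<^esub> (Poly_Mapping.single [] c * x)"
      by (simp add: h map_mult_conv distrib_left)
    also have "\<dots> \<in> I +>\<^bsub>?F\<^esub> (Poly_Mapping.single [] c * x)"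
      using hI by (auto simp: a_r_coset_def')
    finally show ?thesis
      using a_repr_independence[OF _ x a_subgroup] by (simp add: map_mult_conv)
  qed
  moreover have "x \<in> I +>\<^bsub>?F\<^esub> x"
    using assms by (rule a_rcos_self)
  ultimately show ?thesis
    unfolding quotient_algebra_simps by blast
qed

lemma ring_quotient_algebra: "ring (quotient_algebra (free_algebra X) I)"
proof -
  interpret q: ring "free_algebra X Quot I"
    by (rule quotient_is_ring)
  show ?thesis
  proof (rule ringI)
    show "abelian_group (quotient_algebra (free_algebra X) I)"
      by (rule abelian_groupI; simp add: quotient_algebra_simps)
        (erule (2) q.a_assoc | erule (1) q.a_comm | metis q.l_neg q.a_inv_closed)+
    show "Group.monoid (quotient_algebra (free_algebra X) I)"
      by (rule monoidI) (auto simp: quotient_algebra_simps q.m_assoc)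
  qed (simp_all add: quotient_algebra_simps q.l_distr q.r_distr)
qed

lemma vectorspace_quotient_algebra:
  "vectorspace class_ring (quotient_algebra (free_algebra X) I)"
proof -
  let ?F = "free_algebra X :: ('k, 'g list \<Rightarrow>\<^sub>0 'k) module"
  let ?Q = "quotient_algebra ?F I"
  interpret q: ring ?Q
    by (rule ring_quotient_algebra)
  have coset: "\<exists>p \<in> carrier ?F. x = I +>\<^bsub>?F\<^esub> p" if "x \<in> carrier ?Q" for x
    using that by (auto simp: quotient_algebra_simps FactRing_def A_RCOSETS_def')
  have closed: "I +>\<^bsub>?F\<^esub> p \<in> carrier ?Q" if "p \<in> carrier ?F" for p
    using that by (auto simp: quotient_algebra_simps FactRing_def A_RCOSETS_def')
  have smult_closed: "c \<odot>\<^bsub>?F\<^esub> p \<in> carrier ?F" if "p \<in> carrier ?F" for c p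
    using that keys_mult_lists[of "Poly_Mapping.single [] c" X p] by (simp add: map_mult_conv)
  have add: "(I +>\<^bsub>?F\<^esub> p) \<oplus>\<^bsub>?Q\<^esub> (I +>\<^bsub>?F\<^esub> q) = I +>\<^bsub>?F\<^esub> (p + q)"
    if "p \<in> carrier ?F" "q \<in> carrier ?F" for p q
    using a_rcos_sum[OF that] by (simp add: quotient_algebra_simps FactRing_def)
  have "Module.module class_ring ?Q"
  proof (rule moduleI)
    show "abelian_group ?Q" ..
    show "cring (class_ring :: 'k ring)" ..
    fix c d :: 'k and x assume "x \<in> carrier ?Q"
    then obtain p where p: "p \<in> carrier ?F" "x = I +>\<^bsub>?F\<^esub> p"
      using coset by blast
    show "c \<odot>\<^bsub>?Q\<^esub> x \<in> carrier ?Q"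
      unfolding p(2) smult_coset[OF p(1)] by (intro closed smult_closed p)
    show "\<one>\<^bsub>class_ring\<^esub> \<odot>\<^bsub>?Q\<^esub> x = x"
      using p by (simp only: smult_coset) (simp add: map_mult_conv flip: zero_list_def)
    show "(c \<otimes>\<^bsub>class_ring\<^esub> d) \<odot>\<^bsub>?Q\<^esub> x = c \<odot>\<^bsub>?Q\<^esub> (d \<odot>\<^bsub>?Q\<^esub> x)"
      using p smult_closed[OF p(1)]
      by (simp only: smult_coset)
        (simp add: map_mult_conv mult_single plus_list_def flip: mult.assoc)
    show "(c \<oplus>\<^bsub>class_ring\<^esub> d) \<odot>\<^bsub>?Q\<^esub> x = c \<odot>\<^bsub>?Q\<^esub> x \<oplus>\<^bsub>?Q\<^esub> d \<odot>\<^bsub>?Q\<^esub> x"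
      using p smult_closed[OF p(1)]
      by (simp only: smult_coset add) (simp add: map_mult_conv single_add distrib_right)
    fix y assume "y \<in> carrier ?Q"
    then obtain q where q: "q \<in> carrier ?F" "y = I +>\<^bsub>?F\<^esub> q"
      using coset by blast
    have "p + q \<in> carrier ?F"
      using p(1) q(1) by (simp add: keys_add_lists)
    then show "c \<odot>\<^bsub>?Q\<^esub> (x \<oplus>\<^bsub>?Q\<^esub> y) = c \<odot>\<^bsub>?Q\<^esub> x \<oplus>\<^bsub>?Q\<^esub> c \<odot>\<^bsub>?Q\<^esub> y"
      using p q smult_closed[OF p(1)] smult_closed[OF q(1)]
      by (simp only: smult_coset add) (simp add: map_mult_conv distrib_left)
  qed
  moreover have "field (class_ring :: 'k ring)" ..
  ultimately show ?thesis
    by (simp add: vectorspace_def)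
qed

end

lemma ring_Q_alg: "ring (Q_alg n :: ('k::field, _) module)"
  unfolding Q_alg_def by (rule ring_quotient_algebra[OF rel_ideal])

text \<open>In particular the locale constant \<^const>\<open>vectorspace.basis\<close> has its intended
  meaning for \<open>Q_alg n\<close>.\<close>

lemma vectorspace_Q_alg: "vectorspace class_ring (Q_alg n :: ('k::field, _) module)"
  unfolding Q_alg_def by (rule vectorspace_quotient_algebra[OF rel_ideal])

lemma z_elt_closed:
  assumes "A \<subseteq> {1..n}" "i \<in> {1..n} - A"
  shows "z_elt n A i \<in> carrier (Q_alg n :: ('k::field, _) module)"
proof -
  have "(A, i) \<in> gens n"
    using assms by (simp add: gens_def)
  from free_gen_closed[OF this] show ?thesis
    by (auto simp: z_elt_def Q_alg_def quotient_algebra_simps FactRing_def A_RCOSETS_def'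
        simp del: free_algebra_simps)
qed

lemma z_elt_relations:
  fixes n :: nat
  assumes A: "A \<subseteq> {1..n}" and i: "i \<in> {1..n} - A" and j: "j \<in> {1..n} - A" and ij: "i \<noteq> j"
  shows "z_elt n (insert i A) j \<oplus>\<^bsub>Q_alg n\<^esub> z_elt n A i =
      (z_elt n (insert j A) i \<oplus>\<^bsub>Q_alg n\<^esub> z_elt n A j :: (_ \<Rightarrow>\<^sub>0 'k::field) set)"
    and "z_elt n (insert i A) j \<otimes>\<^bsub>Q_alg n\<^esub> z_elt n A i =
      (z_elt n (insert j A) i \<otimes>\<^bsub>Q_alg n\<^esub> z_elt n A j :: (_ \<Rightarrow>\<^sub>0 'k::field) set)"
proof -
  let ?F = "free_Q n :: ('k::field, _) module"
  let ?I = "rel_ideal n :: (_ \<Rightarrow>\<^sub>0 'k) set"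
  interpret ideal ?I ?F
    by (rule rel_ideal)
  have rel: "relators n \<subseteq> ?I"
    unfolding rel_ideal_def by (rule genideal_self[OF relators_closed])
  have "(insert i A, j) \<in> gens n" "(A, i) \<in> gens n" "(insert j A, i) \<in> gens n" "(A, j) \<in> gens n"
    using A i j ij by (auto simp: gens_def)
  note g = this[THEN free_gen_closed[where 'k = 'k]]
  have eq: "?I +>\<^bsub>?F\<^esub> p = ?I +>\<^bsub>?F\<^esub> q"
    if "p \<in> carrier ?F" "q \<in> carrier ?F" "p - q \<in> ?I" for p q
  proof (rule a_repr_independence[OF _ that(2) a_subgroup, symmetric])
    have "p = (p - q) \<oplus>\<^bsub>?F\<^esub> q" by simp
    then show "p \<in> ?I +>\<^bsub>?F\<^esub> q"
      using that(3) unfolding a_r_coset_def' by blast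
  qed
  note simps = z_elt_def Q_alg_def quotient_algebra_simps FactRing_def monoid.simps ring.simps
  show "z_elt n (insert i A) j \<oplus>\<^bsub>Q_alg n\<^esub> z_elt n A i =
      (z_elt n (insert j A) i \<oplus>\<^bsub>Q_alg n\<^esub> z_elt n A j :: (_ \<Rightarrow>\<^sub>0 'k) set)"
    unfolding simps a_rcos_sum[OF g(1,2)] a_rcos_sum[OF g(3,4)]
  proof (rule eq)
    show "free_gen (insert i A, j) \<oplus>\<^bsub>?F\<^esub> free_gen (A, i) -
      (free_gen (insert j A, i) \<oplus>\<^bsub>?F\<^esub> free_gen (A, j)) \<in> ?I"
      unfolding free_algebra_simps relators_def
      by (rule subsetD[OF rel[unfolded relators_def]], rule UnI1, rule CollectI)
        (intro exI[of _ A] exI[of _ i] exI[of _ j] conjI refl A i j ij)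
  qed (intro a_closed g)+
  show "z_elt n (insert i A) j \<otimes>\<^bsub>Q_alg n\<^esub> z_elt n A i =
      (z_elt n (insert j A) i \<otimes>\<^bsub>Q_alg n\<^esub> z_elt n A j :: (_ \<Rightarrow>\<^sub>0 'k) set)"
    unfolding simps rcoset_mult_add[OF g(1,2)] rcoset_mult_add[OF g(3,4)]
  proof (rule eq)
    show "free_gen (insert i A, j) \<otimes>\<^bsub>?F\<^esub> free_gen (A, i) -
      (free_gen (insert j A, i) \<otimes>\<^bsub>?F\<^esub> free_gen (A, j)) \<in> ?I"
      unfolding free_algebra_simps relators_def
      by (rule subsetD[OF rel[unfolded relators_def]], rule UnI2, rule CollectI)
        (intro exI[of _ A] exI[of _ i] exI[of _ j] conjI refl A i j ij)
  qed (intro m_closed g)+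
qed

context
  fixes n :: nat and Q :: "('k::field, ((nat set \<times> nat) list \<Rightarrow>\<^sub>0 'k) set) module" (structure)
  defines "Q \<equiv> Q_alg n"
begin

interpretation Q: ring Q
  unfolding Q_def by (rule ring_Q_alg)

lemma r_ord_snoc:
  assumes "distinct (cs @ [c])" "set (cs @ [c]) \<subseteq> {1..n}"
  shows "r_ord n (cs @ [c]) = z_elt n (set cs) c \<oplus> r_ord n cs"
proof -
  let ?f = "\<lambda>ds l. z_elt n (set (take l ds)) (ds ! l) :: (_ \<Rightarrow>\<^sub>0 'k) set"
  have cl: "?f (cs @ [c]) l \<in> carrier Q" if "l < length (cs @ [c])" for l
    unfolding Q_def
  proof (rule z_elt_closed)
    show "set (take l (cs @ [c])) \<subseteq> {1..n}"
      using assms(2) set_take_subset by (rule order.trans[rotated])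
    have "(cs @ [c]) ! l \<notin> set (take l (cs @ [c]))"
      using assms(1) that by (auto simp: in_set_conv_nth nth_eq_iff_index_eq
          simp del: distinct_append take_append)
    then show "(cs @ [c]) ! l \<in> {1..n} - set (take l (cs @ [c]))"
      using assms(2) nth_mem[OF that] by blast
  qed
  have "r_ord n (cs @ [c]) = (\<Oplus>l\<in>insert (length cs) {..<length cs}. ?f (cs @ [c]) l)"
    unfolding r_ord_def Q_def by (simp add: lessThan_Suc)
  also have "\<dots> = ?f (cs @ [c]) (length cs) \<oplus> (\<Oplus>l\<in>{..<length cs}. ?f (cs @ [c]) l)"
    using cl[of "length cs"] cl by (intro Q.finsum_insert) (auto simp del: take_append)
  also have "(\<Oplus>l\<in>{..<length cs}. ?f (cs @ [c]) l) = (\<Oplus>l\<in>{..<length cs}. ?f cs l)"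
  proof (rule Q.finsum_cong')
    show "?f cs \<in> {..<length cs} \<rightarrow> carrier Q"
    proof
      fix l assume "l \<in> {..<length cs}"
      then show "?f cs l \<in> carrier Q"
        using cl[of l] by (simp add: nth_append)
    qed
  qed (auto simp: nth_append)
  finally show ?thesis
    by (simp add: r_ord_def Q_def)
qed

lemma r_ord_closed:
  "distinct cs \<Longrightarrow> set cs \<subseteq> {1..n} \<Longrightarrow> r_ord n cs \<in> carrier Q"
proof (induction cs rule: rev_induct)
  case Nil
  then show ?case by (simp add: r_ord_def flip: Q_def)
next
  case (snoc c cs)
  have "z_elt n (set cs) c \<in> carrier Q"
    using snoc.prems unfolding Q_def by (intro z_elt_closed) auto
  then show ?case
    using snoc by (simp only: r_ord_snoc) simp
qed

lemma r_ord_cong: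
  assumes "distinct cs" "distinct ds" "set cs = set ds" "set cs \<subseteq> {1..n}"
  shows "r_ord n cs = (r_ord n ds :: (_ \<Rightarrow>\<^sub>0 'k) set)"
  using assms
proof (induction "length cs" arbitrary: cs ds rule: less_induct)
  case less
  show ?case
  proof (cases cs rule: rev_cases)
    case Nil
    then show ?thesis using less.prems by simp
  next
    case cs: (snoc cs' c)
    then obtain ds' d where ds: "ds = ds' @ [d]"
      using less.prems(3) by (cases ds rule: rev_cases) auto
    have len: "length ds = length cs"
      using less.prems by (metis distinct_card)
    have dist': "distinct cs'" "distinct ds'"
        and sets: "set cs' = set cs - {c}" "set ds' = set ds - {d}" "c \<in> set cs" "d \<in> set ds"
      using less.prems(1,2) cs ds by auto
    show ?thesis
    proof (cases "c = d")
      case True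
      then have eq: "set cs' = set ds'"
        using sets less.prems(3) by simp
      have "set cs' \<subseteq> {1..n}"
        using sets(1) less.prems(4) by blast
      then have "r_ord n cs' = (r_ord n ds' :: (_ \<Rightarrow>\<^sub>0 'k) set)"
        by (intro less.hyps dist' eq) (simp_all add: cs)
      then show ?thesis
        using less.prems unfolding cs ds True by (simp only: r_ord_snoc eq)
    next
      case False
      define es where "es = sorted_list_of_set (set cs - {c, d})"
      have es: "distinct es" "set es = set cs - {c, d}"
        by (simp_all add: es_def)
      have d: "d \<in> set cs"
        using sets(4) less.prems(3) by simp
      have cs': "set cs' = insert d (set es)"
        unfolding sets(1) es(2) using d False by blast
      have ds': "set ds' = insert c (set es)"
        unfolding sets(2) es(2) less.prems(3)[symmetric] using sets(3) False by blast
      have ce: "c \<in> {1..n} - set es" and de: "d \<in> {1..n} - set es" and E: "set es \<subseteq> {1..n}"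
        unfolding es(2) using sets(3) d less.prems(4) by blast+
      have dist: "distinct cs'" "distinct ds'" "distinct (es @ [c])" "distinct (es @ [d])"
        using dist' es(1) ce de by auto
      have sub: "set cs' \<subseteq> {1..n}" "set ds' \<subseteq> {1..n}"
        using cs' ds' ce de E by auto
      have 1: "r_ord n cs' = (r_ord n (es @ [d]) :: (_ \<Rightarrow>\<^sub>0 'k) set)"
        by (rule less.hyps) (use E de es(1) in \<open>simp_all add: cs dist sub cs'\<close>)
      have 2: "r_ord n ds' = (r_ord n (es @ [c]) :: (_ \<Rightarrow>\<^sub>0 'k) set)"
        by (rule less.hyps) (use E ce es(1) len ds in \<open>simp_all add: dist sub ds'\<close>)
      have zc: "z_elt n (set es) c \<in> carrier Q" "z_elt n (set es) d \<in> carrier Q"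
          "z_elt n (insert d (set es)) c \<in> carrier Q" "z_elt n (insert c (set es)) d \<in> carrier Q"
        unfolding Q_def by (rule z_elt_closed; use E ce de False in blast)+
      have rc: "r_ord n es \<in> carrier Q"
        using es E by (intro r_ord_closed) auto
      have "r_ord n cs = z_elt n (insert d (set es)) c \<oplus> r_ord n (es @ [d])"
        using less.prems(1,4) unfolding cs by (simp only: r_ord_snoc cs' 1)
      also have "r_ord n (es @ [d]) = z_elt n (set es) d \<oplus> r_ord n es"
        using E de by (intro r_ord_snoc dist) auto
      also have "z_elt n (insert d (set es)) c \<oplus> (z_elt n (set es) d \<oplus> r_ord n es) =
          (z_elt n (insert d (set es)) c \<oplus> z_elt n (set es) d) \<oplus> r_ord n es"
        using zc rc by (simp add: Q.a_assoc)
      also have "z_elt n (insert d (set es)) c \<oplus> z_elt n (set es) d =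
          z_elt n (insert c (set es)) d \<oplus> z_elt n (set es) c"
        unfolding Q_def using E ce de False by (intro z_elt_relations(1)) auto
      also have "\<dots> \<oplus> r_ord n es = z_elt n (insert c (set es)) d \<oplus> (z_elt n (set es) c \<oplus> r_ord n es)"
        using zc rc by (simp add: Q.a_assoc)
      also have "z_elt n (set es) c \<oplus> r_ord n es = r_ord n ds'"
        unfolding 2 using E ce by (intro r_ord_snoc[symmetric] dist) auto
      also have "z_elt n (insert c (set es)) d \<oplus> r_ord n ds' = r_ord n ds"
        using less.prems(2,3,4) unfolding ds by (simp only: r_ord_snoc ds')
      finally show ?thesis .
    qed
  qed
qed

end

lemma r_elt_eq_r_ord:
  assumes "distinct cs" "set cs \<subseteq> {1..n}"
  shows "r_elt n (set cs) = (r_ord n cs :: (_ \<Rightarrow>\<^sub>0 'k::field) set)"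
  unfolding r_elt_def using assms by (intro r_ord_cong) auto

end

theory Submission
  imports Defs
begin

text \<open>
  For a chain \<open>\<emptyset> = C\<^sub>0 \<subset> C\<^sub>1 \<subset> \<dots> \<subset> C\<^sub>u = A\<close> in which each set has one element more than the
  one before, consider the polynomial
  \<open>P\<^sub>A(t) = (t - z\<^sub>u) \<dots> (t - z\<^sub>1)\<close>, where \<open>z\<^sub>l\<close> is the generator that leads from \<open>C\<^bsub>l-1\<^esub>\<close> to
  \<open>C\<^sub>l\<close>. The defining relations say exactly that \<open>P\<^sub>A\<close> does not depend on the chain. Let \<open>e\<^sub>j(A)\<close> be
  the coefficient of \<open>t\<^bsup>u-j\<^esup>\<close> in \<open>P\<^sub>A(t)\<close> without its sign, so that \<open>e\<^sub>0(A) = 1\<close> and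
  \<open>e\<^sub>1(A) = r(A)\<close>. If \<open>r(A\<^sub>1) \<dots> r(A\<^sub>s)\<close> has weight \<open>|A\<^sub>1| + \<dots> + |A\<^sub>s|\<close>, then \<open>e\<^sub>j(A)\<close> is \<open>r(A:j)\<close> plus
  terms of smaller weight.

  Spanning. In terms of the elements \<open>r(A)\<close> the quadratic relations become
  \<open>r(B) (r(B - {i}) - r(B - {j})) = \<close> terms of smaller weight. Hence, up to smaller weight, the
  product of the \<open>r(A)\<close> along a descending chain depends only on its top set and its length
  (\<open>chain_equiv_descent\<close>). If \<open>C \<subseteq> A\<close> and \<open>|C| = |A| - j\<close>, the product \<open>r(A:j) r(C)\<close> can
  therefore be replaced by \<open>r(A:j+1)\<close>. Induction on the weight removes all forbidden neighbours
  (\<open>lower_span_subset_admissible_span\<close>).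

  Independence. Let \<open>Q\<^sub>n\<close> act from the right on the vector space whose basis consists of the
  normal words, that is of the admissible words in letters \<open>(A, j)\<close>, where \<open>(A, j)\<close> plays the part
  of \<open>e\<^sub>j(A)\<close>. Put \<open>E\<^sub>A = \<Sum>\<^sub>j e\<^sub>j(A) s\<^sup>j\<close>. For \<open>C \<subseteq> A\<close> the factorisation of \<open>P\<^sub>A\<close> through \<open>P\<^sub>C\<close>
  says that \<open>E\<^sub>A E\<^sub>C\<^bsup>-1\<^esup>\<close> is a polynomial in \<open>s\<close> of degree at most \<open>|A| - |C|\<close>. When
  \<open>|C| = |A| - j\<close>, the vanishing of its coefficient of degree \<open>j + k\<close> expresses the forbidden product
  \<open>e\<^sub>j(A) e\<^sub>k(C)\<close> by \<open>e\<^bsub>j+k\<^esub>(A)\<close> and products that are allowed or begin with a shorter word. This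
  forces a definition of the action on words, and the point of the whole proof is that the action so
  defined does satisfy the degree bound on all normal words (\<open>degree_bounded_normal\<close>). The reason
  is that \<open>E\<^sub>B E\<^sub>C\<^bsup>-1\<^esup> = E\<^sub>B E\<^sub>A\<^bsup>-1\<^esup> E\<^sub>A E\<^sub>C\<^bsup>-1\<^esup>\<close>: the bounds for \<open>(B, A)\<close> and \<open>(B, C)\<close> imply the one for
  \<open>(A, C)\<close>. The case \<open>|A| = |C| + 1\<close> contains the defining relations. An admissible product
  of elements \<open>r(A:j)\<close>, applied to the empty word, gives the corresponding normal word plus words
  of smaller weight (\<open>has_leading_word_flatten\<close>). Different admissible products thus have
  different leading words and are linearly independent.
\<close>

section \<open>Linear extension from words\<close>

text \<open>This is the scalar multiplication of \<^const>\<open>free_algebra\<close>, see \<open>map_mult_conv\<close>. Written as a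
  product it is available on words over any alphabet.\<close>
definition scal :: "'k::field \<Rightarrow> ('g list \<Rightarrow>\<^sub>0 'k) \<Rightarrow> ('g list \<Rightarrow>\<^sub>0 'k)" where
  "scal c p = Poly_Mapping.single [] c * p"

lemma lookup_scal [simp]: "Poly_Mapping.lookup (scal c p) w = c * Poly_Mapping.lookup p w"
  by (simp add: scal_def map.rep_eq when_def flip: map_mult_conv)

interpretation words: vector_space "scal :: 'k::field \<Rightarrow> ('g list \<Rightarrow>\<^sub>0 'k) \<Rightarrow> _"
  by unfold_locales
    (auto intro!: poly_mapping_eqI simp: lookup_add algebra_simps)

definition lin_ext :: "('g list \<Rightarrow> ('h list \<Rightarrow>\<^sub>0 'k)) \<Rightarrow> ('g list \<Rightarrow>\<^sub>0 'k::field) \<Rightarrow> ('h list \<Rightarrow>\<^sub>0 'k)" where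
  "lin_ext \<phi> x = (\<Sum>w\<in>Poly_Mapping.keys x. scal (Poly_Mapping.lookup x w) (\<phi> w))"

lemma lin_ext_superset:
  assumes "finite S" "Poly_Mapping.keys x \<subseteq> S"
  shows "lin_ext \<phi> x = (\<Sum>w\<in>S. scal (Poly_Mapping.lookup x w) (\<phi> w))"
  unfolding lin_ext_def using assms
  by (intro sum.mono_neutral_left) (auto simp: in_keys_iff)

lemma lin_ext_add: "lin_ext \<phi> (x + y) = lin_ext \<phi> x + lin_ext \<phi> y"
proof -
  let ?S = "Poly_Mapping.keys x \<union> Poly_Mapping.keys y"
  have "Poly_Mapping.keys (x + y) \<subseteq> ?S" by (rule Poly_Mapping.keys_add)
  then show ?thesis
    by (simp add: lin_ext_superset[of ?S] lookup_add words.scale_left_distrib sum.distrib)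
qed

lemma lin_ext_scal: "lin_ext \<phi> (scal c x) = scal c (lin_ext \<phi> x)"
proof -
  have "Poly_Mapping.keys (scal c x) \<subseteq> Poly_Mapping.keys x"
    by (auto simp: in_keys_iff)
  then show ?thesis
    by (simp add: lin_ext_superset[of "Poly_Mapping.keys x"] words.scale_sum_right)
qed

lemma lin_ext_0 [simp]: "lin_ext \<phi> 0 = 0"
  by (simp add: lin_ext_def)

lemma lin_ext_uminus: "lin_ext \<phi> (- x) = - lin_ext \<phi> x"
  using lin_ext_add[of \<phi> x "- x"] by (simp add: eq_neg_iff_add_eq_0 add.commute)

lemma lin_ext_diff: "lin_ext \<phi> (x - y) = lin_ext \<phi> x - lin_ext \<phi> y"
  using lin_ext_add[of \<phi> x "- y"] by (simp add: lin_ext_uminus)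

lemma lin_ext_single [simp]: "lin_ext \<phi> (Poly_Mapping.single w 1) = \<phi> w"
  by (simp add: lin_ext_def)

lemma lin_ext_cong:
  "(\<And>w. w \<in> Poly_Mapping.keys x \<Longrightarrow> \<phi> w = \<psi> w) \<Longrightarrow> lin_ext \<phi> x = lin_ext \<psi> x"
  by (simp add: lin_ext_def)

lemma lin_ext_ident: "lin_ext (\<lambda>w. Poly_Mapping.single w 1) x = x"
proof (rule poly_mapping_eqI)
  fix v
  have "Poly_Mapping.lookup (lin_ext (\<lambda>w. Poly_Mapping.single w 1) x) v
      = (\<Sum>w\<in>Poly_Mapping.keys x. if w = v then Poly_Mapping.lookup x v else 0)"
    unfolding lin_ext_def lookup_sum by (intro sum.cong) (auto simp: lookup_single when_def)
  also have "\<dots> = Poly_Mapping.lookup x v"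
    by (simp add: in_keys_iff)
  finally show "Poly_Mapping.lookup (lin_ext (\<lambda>w. Poly_Mapping.single w 1) x) v = Poly_Mapping.lookup x v" .
qed

lemma word_expansion:
  "x = (\<Sum>w\<in>Poly_Mapping.keys x. scal (Poly_Mapping.lookup x w) (Poly_Mapping.single w 1))"
  using lin_ext_ident[of x] by (simp add: lin_ext_def)

definition supported :: "'g list set \<Rightarrow> ('g list \<Rightarrow>\<^sub>0 'k::field) set" where
  "supported S = {x. Poly_Mapping.keys x \<subseteq> S}"

lemma supported_0 [simp]: "0 \<in> supported S"
  by (simp add: supported_def)

lemma supported_single [simp]: "Poly_Mapping.single w 1 \<in> supported S \<longleftrightarrow> w \<in> S"
  by (simp add: supported_def)

lemma supported_add: "x \<in> supported S \<Longrightarrow> y \<in> supported S \<Longrightarrow> x + y \<in> supported S"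
  using Poly_Mapping.keys_add[of x y] by (auto simp: supported_def)

lemma supported_diff: "x \<in> supported S \<Longrightarrow> y \<in> supported S \<Longrightarrow> x - y \<in> supported S"
  using Poly_Mapping.keys_add[of x "- y"] by (auto simp: supported_def)

lemma supported_sum: "(\<And>i. i \<in> I \<Longrightarrow> f i \<in> supported S) \<Longrightarrow> sum f I \<in> supported S"
  by (induction I rule: infinite_finite_induct) (auto intro: supported_add)

lemma supported_scal: "x \<in> supported S \<Longrightarrow> scal c x \<in> supported S"
  by (auto simp: supported_def in_keys_iff)

lemma supported_mono: "x \<in> supported S \<Longrightarrow> S \<subseteq> T \<Longrightarrow> x \<in> supported T"
  by (auto simp: supported_def)

lemma supported_lin_ext:
  assumes "x \<in> supported S" "\<And>w. w \<in> S \<Longrightarrow> \<phi> w \<in> supported T"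
  shows "lin_ext \<phi> x \<in> supported T"
  unfolding lin_ext_def using assms by (intro supported_sum supported_scal) (auto simp: supported_def)

section \<open>Quotients of power series\<close>

text \<open>A sequence \<open>g\<close> stands for the power series \<open>\<Sum>\<^sub>m g m s\<^sup>m\<close> with coefficients in a right module,
  and \<open>E k\<close> for the right multiplication by an element \<open>e\<^sub>k\<close>, where \<open>e\<^sub>0 = 1\<close>. The sequence defined here
  is the quotient of \<open>g\<close> by \<open>\<Sum>\<^sub>k e\<^sub>k s\<^sup>k\<close>, obtained by comparing coefficients.\<close>
function series_quotient :: "(nat \<Rightarrow> 'a \<Rightarrow> 'a) \<Rightarrow> (nat \<Rightarrow> 'a::ab_group_add) \<Rightarrow> nat \<Rightarrow> 'a" where
  "series_quotient E g m = g m - (\<Sum>i<m. E (m - i) (series_quotient E g i))"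
  by auto
termination by (relation "measure (\<lambda>(E, g, m). m)") auto

declare series_quotient.simps [simp del]

lemma series_quotient_cong:
  assumes "\<And>i. i \<le> m \<Longrightarrow> g i = h i"
  shows "series_quotient E g m = series_quotient E h m"
  using assms
proof (induction m rule: less_induct)
  case (less m)
  have "series_quotient E g i = series_quotient E h i" if "i < m" for i
    using that less.prems by (intro less.IH) auto
  then show ?case
    using less.prems[of m] by (simp add: series_quotient.simps[of E g m] series_quotient.simps[of E h m])
qed

section \<open>Normal words and the action of the elements \<open>e\<^sub>k(C)\<close>\<close>

text \<open>The letter \<open>(A, j)\<close> stands for \<open>e\<^sub>j(A)\<close>; it has the same type as a generator \<open>z\<^bsub>A,i\<^esub>\<close>, but here
  \<open>j\<close> is a degree and not an element of the base set. Words are stored with the last factor first,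
  since the algebra acts from the right: \<open>(A, j) # u\<close> stands for the product of \<open>u\<close> and
  \<open>e\<^sub>j(A)\<close>.\<close>
type_synonym letter = "nat set \<times> nat"

fun blocked :: "letter list \<Rightarrow> nat set \<Rightarrow> bool" where
  "blocked [] C \<longleftrightarrow> False"
| "blocked ((A, j) # u) C \<longleftrightarrow> C \<subseteq> A \<and> card C = card A - j"

fun normal_word :: "nat \<Rightarrow> letter list \<Rightarrow> bool" where
  "normal_word n [] \<longleftrightarrow> True"
| "normal_word n ((A, j) # u) \<longleftrightarrow> A \<subseteq> {1..n} \<and> 1 \<le> j \<and> j \<le> card A \<and> \<not> blocked u A \<and> normal_word n u"

definition free_words :: "nat \<Rightarrow> nat set \<Rightarrow> letter list set" where
  "free_words n C = {w. normal_word n w \<and> \<not> blocked w C}"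

text \<open>Appending \<open>e\<^sub>k(C)\<close> without regard to forbidden neighbours. The conventions
  \<open>e\<^sub>0(C) = 1\<close> and \<open>e\<^sub>k(C) = 0\<close> for \<open>k > |C|\<close> let all sums over degrees run over full ranges.\<close>
definition append_sym_word :: "nat set \<Rightarrow> nat \<Rightarrow> letter list \<Rightarrow> (letter list \<Rightarrow>\<^sub>0 'k::field)" where
  "append_sym_word C k w = (if k = 0 then Poly_Mapping.single w 1
     else if k \<le> card C then Poly_Mapping.single ((C, k) # w) 1 else 0)"

abbreviation append_sym :: "nat set \<Rightarrow> nat \<Rightarrow> (letter list \<Rightarrow>\<^sub>0 'k::field) \<Rightarrow> (letter list \<Rightarrow>\<^sub>0 'k)" where
  "append_sym C k \<equiv> lin_ext (append_sym_word C k)"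

text \<open>The right multiplication by \<open>e\<^sub>k(C)\<close>. For a forbidden product, the formula is the
  vanishing of the coefficient of degree \<open>j + k\<close> in \<open>u E\<^sub>A E\<^sub>C\<^bsup>-1\<^esup>\<close>, solved for
  \<open>u e\<^sub>j(A) e\<^sub>k(C)\<close>. The quotient has coefficients \<open>u, f 1, f 2, \<dots>\<close>.
  Those with \<open>0 < i < j\<close> consist of words to which letters \<open>(C, l)\<close> may simply be appended, and only
  \<open>u\<close> itself needs the recursive call. The coefficient of degree \<open>0\<close> is therefore taken out of the
  sequence \<open>f\<close>: its contribution is subtracted in advance.\<close>
fun sym_act_word :: "nat set \<Rightarrow> letter list \<Rightarrow> nat \<Rightarrow> (letter list \<Rightarrow>\<^sub>0 'k::field)" where
  "sym_act_word C [] k = append_sym_word C k []"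
| "sym_act_word C ((A, j) # u) k =
     (if k = 0 \<or> k > card C \<or> \<not> (C \<subseteq> A \<and> card C = card A - j) then append_sym_word C k ((A, j) # u)
      else
        let f = series_quotient (append_sym C) (\<lambda>m. if m = 0 then 0 else append_sym_word A m u - sym_act_word C u m)
        in append_sym_word A (j + k) u - sym_act_word C u (j + k) - (\<Sum>i<j. append_sym C (j + k - i) (f i))
           + append_sym C k (sym_act_word C u j + (\<Sum>i<j. append_sym C (j - i) (f i))))"

declare sym_act_word.simps(2) [simp del]

definition sym_act :: "nat set \<Rightarrow> nat \<Rightarrow> (letter list \<Rightarrow>\<^sub>0 'k::field) \<Rightarrow> (letter list \<Rightarrow>\<^sub>0 'k)" where
  "sym_act C k = lin_ext (\<lambda>w. sym_act_word C w k)"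

lemma sym_act_word_unblocked:
  "\<not> blocked w C \<or> k = 0 \<or> k > card C \<Longrightarrow> sym_act_word C w k = append_sym_word C k w"
  by (cases "(C, w, k)" rule: sym_act_word.cases) (auto simp: sym_act_word.simps(2))

lemma sym_act_single [simp]: "sym_act C k (Poly_Mapping.single w 1) = sym_act_word C w k"
  by (simp add: sym_act_def)

lemma sym_act_add: "sym_act C k (x + y) = sym_act C k x + sym_act C k y"
  by (simp add: sym_act_def lin_ext_add)

lemma sym_act_diff: "sym_act C k (x - y) = sym_act C k x - sym_act C k y"
  by (simp add: sym_act_def lin_ext_diff)

lemma sym_act_scal: "sym_act C k (scal c x) = scal c (sym_act C k x)"
  by (simp add: sym_act_def lin_ext_scal)

lemma sym_act_zero [simp]: "sym_act C k 0 = 0"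
  by (simp add: sym_act_def)

lemma sym_act_0 [simp]: "sym_act C 0 x = x"
  by (simp add: sym_act_def sym_act_word_unblocked append_sym_word_def lin_ext_ident)

lemma sym_act_above [simp]: "k > card C \<Longrightarrow> sym_act C k x = 0"
  by (simp add: sym_act_def sym_act_word_unblocked append_sym_word_def lin_ext_def)

lemma sym_act_eq_append:
  "x \<in> supported (free_words n C) \<Longrightarrow> sym_act C k x = append_sym C k x"
  unfolding sym_act_def
  by (rule lin_ext_cong) (auto simp: supported_def free_words_def sym_act_word_unblocked)

lemma append_sym_word_free:
  assumes "C \<subseteq> {1..n}" "w \<in> free_words n C"
  shows "append_sym_word C k w \<in> supported (free_words n C)"
  using assms by (auto simp: append_sym_word_def free_words_def)

lemma append_sym_free:
  assumes "C \<subseteq> {1..n}" "x \<in> supported (free_words n C)"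
  shows "append_sym C k x \<in> supported (free_words n C)"
  by (rule supported_lin_ext[OF assms(2) append_sym_word_free[OF assms(1)]])

lemma series_quotient_append_free:
  assumes C: "C \<subseteq> {1..n}"
    and g: "\<And>i. i \<le> m \<Longrightarrow> g i \<in> supported (free_words n C)"
  shows "series_quotient (append_sym C) g m \<in> supported (free_words n C)"
  using g
proof (induction m rule: less_induct)
  case (less m)
  then show ?case
    by (subst series_quotient.simps) (intro supported_diff supported_sum append_sym_free[OF C]; simp)
qed

text \<open>A product with \<open>e\<^sub>k(C)\<close>, \<open>k \<ge> 1\<close>, is a combination of words that end in a letter of \<open>C\<close> or
  were changed to \<open>(A, j + k)\<close> at the end, and neither of these blocks \<open>C\<close>. This is what keeps the
  recursion in the definition of the action one level deep.\<close>
lemma sym_act_word_into_free: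
  assumes "normal_word n w" "C \<subseteq> {1..n}" "k \<ge> 1"
  shows "(sym_act_word C w k :: _ \<Rightarrow>\<^sub>0 'k::field) \<in> supported (free_words n C)"
  using assms
proof (induction w arbitrary: k)
  case Nil
  then show ?case by (auto simp: append_sym_word_def free_words_def)
next
  case (Cons a u)
  obtain A j where a: "a = (A, j)" by force
  show ?case
  proof (cases "k > card C \<or> \<not> blocked (a # u) C")
    case True
    then show ?thesis
      using Cons.prems append_sym_word_free[of C n "a # u" k]
      by (auto simp: sym_act_word_unblocked free_words_def append_sym_word_def)
  next
    case False
    have A: "A \<subseteq> {1..n}" "1 \<le> j" "j \<le> card A" "\<not> blocked u A" "normal_word n u"
      using Cons.prems(1) by (auto simp: a)
    have C: "C \<subseteq> A" "card C = card A - j" and k: "k \<le> card C"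
      using False by (auto simp: a)
    let ?U = "supported (free_words n C) :: (_ \<Rightarrow>\<^sub>0 'k) set"
    have Au: "append_sym_word A m u \<in> ?U" if "m \<ge> 1" "m \<noteq> j" for m
      using that A C by (auto simp: append_sym_word_def free_words_def)
    have Ru: "sym_act_word C u m \<in> ?U" if "m \<ge> 1" for m
      using Cons.IH[OF A(5) Cons.prems(2) that] .
    have F: "series_quotient (append_sym C) (\<lambda>m. if m = 0 then 0 else append_sym_word A m u - sym_act_word C u m) i \<in> ?U"
      if "i < j" for i
      using that by (intro series_quotient_append_free[OF Cons.prems(2)]) (auto intro!: supported_diff Au Ru)
    show ?thesis
      using False Cons.prems(3) A(2)
      unfolding a sym_act_word.simps(2) Let_def
      by (auto simp del: blocked.simps simp: C intro!: supported_add supported_diff supported_sum append_sym_free[OF Cons.prems(2)] Au Ru F)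
  qed
qed

lemma series_quotient_0: "series_quotient E g 0 = g 0"
  by (subst series_quotient.simps) simp

lemma series_quotient_add:
  assumes "\<And>k x y. E k (x + y) = E k x + E k y"
  shows "series_quotient E (\<lambda>m. g m + h m) m = series_quotient E g m + series_quotient E h m"
proof (induction m rule: less_induct)
  case (less m)
  then show ?case
    by (simp add: series_quotient.simps[of E _ m] assms sum.distrib)
qed

lemma series_quotient_zero:
  assumes "\<And>k. E k 0 = 0" "\<And>i. i \<le> m \<Longrightarrow> g i = 0"
  shows "series_quotient E g m = 0"
  using assms(2)
proof (induction m rule: less_induct)
  case (less m)
  then show ?case
    by (simp add: series_quotient.simps[of E _ m] assms(1))
qed

lemma series_quotient_sum:
  assumes "\<And>k x y. E k (x + y) = E k x + E k y" "\<And>k. E k 0 = 0"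
  shows "series_quotient E (\<lambda>m. \<Sum>i\<in>I. g i m) m = (\<Sum>i\<in>I. series_quotient E (g i) m)"
  by (induction I rule: infinite_finite_induct) (simp_all add: series_quotient_add[OF assms(1)] series_quotient_zero assms(2))

text \<open>Multiplying a series by \<open>s\<^sup>b\<close> commutes with taking quotients.\<close>
lemma series_quotient_shift:
  assumes "\<And>k. E k 0 = 0"
  shows "series_quotient E (\<lambda>m. if m < b then 0 else g (m - b)) m = (if m < b then 0 else series_quotient E g (m - b))"
proof (induction m rule: less_induct)
  case (less m)
  let ?h = "\<lambda>m. if m < b then 0 else g (m - b)"
  show ?case
  proof (cases "m < b")
    case True
    then show ?thesis by (simp add: series_quotient_zero assms)
  next
    case False
    have "(\<Sum>i<m. E (m - i) (series_quotient E ?h i)) = (\<Sum>i<m. if i < b then 0 else E (m - i) (series_quotient E g (i - b)))"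
      by (intro sum.cong) (auto simp: less.IH assms)
    also have "\<dots> = (\<Sum>i\<in>{b..<m}. E (m - i) (series_quotient E g (i - b)))"
      by (intro sum.mono_neutral_cong_right) auto
    also have "\<dots> = (\<Sum>i<m - b. E (m - b - i) (series_quotient E g i))"
      using False
      by (intro sum.reindex_bij_witness[of _ "\<lambda>i. i + b" "\<lambda>i. i - b"]) auto
    finally show ?thesis
      using False by (simp add: series_quotient.simps[of E _ m] series_quotient.simps[of E _ "m - b"])
  qed
qed

lemma sum_series_quotient:
  assumes "\<And>x. E 0 x = x"
  shows "(\<Sum>i\<le>m. E (m - i) (series_quotient E g i)) = g m"
proof -
  have "(\<Sum>i\<le>m. E (m - i) (series_quotient E g i)) = (\<Sum>i<m. E (m - i) (series_quotient E g i)) + series_quotient E g m"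
    by (simp add: assms lessThan_Suc_atMost[symmetric])
  then show ?thesis
    by (simp add: series_quotient.simps[of E _ m])
qed

section \<open>The degree bound for \<open>E\<^sub>A E\<^sub>C\<^bsup>-1\<^esup>\<close>\<close>

text \<open>If \<open>A\<close> may follow \<open>w\<close>, then \<open>w E\<^sub>A\<close> is obtained by appending letters, and its quotient \<open>f\<close> by
  \<open>E\<^sub>C\<close> has degree at most \<open>|A| - |C|\<close> because the action was defined so as to kill the higher
  coefficients. The lower coefficients are recorded as well: apart from \<open>w\<close> and the
  word \<open>(A, j) # w\<close> in the top coefficient, they involve only words that \<open>C\<close> may follow.\<close>
lemma free_words_quotient:
  fixes w :: "letter list"
  assumes A: "A \<subseteq> {1..n}" and CA: "C \<subset> A" and w: "w \<in> free_words n A"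
  defines "j \<equiv> card A - card C"
  defines "f \<equiv> series_quotient (sym_act C) (\<lambda>m. sym_act_word A w m :: _ \<Rightarrow>\<^sub>0 'k::field)"
  shows "f 0 = Poly_Mapping.single w 1"
    and "0 < i \<Longrightarrow> i < j \<Longrightarrow> f i \<in> supported (free_words n C)"
    and "f j - Poly_Mapping.single ((A, j) # w) 1 \<in> supported (free_words n C)"
    and "i > j \<Longrightarrow> f i = 0"
proof -
  let ?U = "supported (free_words n C) :: (_ \<Rightarrow>\<^sub>0 'k) set"
  define g where "g = (\<lambda>m. append_sym_word A m w :: _ \<Rightarrow>\<^sub>0 'k)"
  define r where "r = (\<lambda>m. sym_act_word C w m :: _ \<Rightarrow>\<^sub>0 'k)"
  define h where "h = series_quotient (append_sym C) (\<lambda>m. if m = 0 then 0 else g m - r m)"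
  have C: "C \<subseteq> {1..n}" "finite A" "C \<subseteq> A"
    using A CA finite_subset[OF A] by auto
  have cardA: "card C < card A"
    using C CA by (intro psubset_card_mono) auto
  then have j: "0 < j" "j \<le> card A" "card C = card A - j" "card A = j + card C"
    by (auto simp: j_def)
  have w': "normal_word n w" "\<not> blocked w A"
    using w by (auto simp: free_words_def)
  have f_eq: "f = series_quotient (sym_act C) g"
    by (simp add: f_def g_def sym_act_word_unblocked w' cong: series_quotient_cong)
  have f_rec: "f m = g m - (\<Sum>i<m. sym_act C (m - i) (f i))" for m
    unfolding f_eq by (rule series_quotient.simps)
  have h_rec: "h m = (if m = 0 then 0 else g m - r m) - (\<Sum>i<m. append_sym C (m - i) (h i))" for m
    unfolding h_def by (rule series_quotient.simps)
  have gU: "g m \<in> ?U" if "0 < m" "m \<noteq> j" for m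
    using that A j(1,2) w' j(3) cardA by (auto simp: g_def append_sym_word_def free_words_def)
  have rU: "r m \<in> ?U" if "0 < m" for m
    unfolding r_def using w' C that by (intro sym_act_word_into_free) auto
  have hU: "h i \<in> ?U" if "i < j" for i
    unfolding h_def using that by (intro series_quotient_append_free C) (auto intro!: supported_diff gU rU)
  have h_eq: "h = series_quotient (append_sym C) (\<lambda>m. if m = 0 then 0 else append_sym_word A m w - sym_act_word C w m)"
    unfolding h_def g_def r_def by (rule refl)
  have h0: "h 0 = 0"
    by (subst h_rec) simp
  show f0: "f 0 = Poly_Mapping.single w 1"
    by (simp add: f_eq series_quotient_0 g_def append_sym_word_def)
  (* Only the coefficient of degree 0 needs the recursive action; on the others the action appends. *)
  have S: "(\<Sum>i'<i. sym_act C (m - i') (f i')) = r m + (\<Sum>i'<i. append_sym C (m - i') (h i'))"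
    if "0 < i" "i \<le> j" "\<And>i'. 0 < i' \<Longrightarrow> i' < i \<Longrightarrow> f i' = h i'" for i m
  proof -
    obtain i0 where i0: "i = Suc i0" using \<open>0 < i\<close> by (cases i) auto
    show ?thesis
      unfolding i0 sum.lessThan_Suc_shift
      using that(2) hU[THEN sym_act_eq_append]
      by (auto simp: f0 h0 r_def that(3) i0 intro!: sum.cong)
  qed
  have fh: "f i = h i" if "0 < i" "i < j" for i
    using that
  proof (induction i rule: less_induct)
    case (less i)
    have "f i' = h i'" if "0 < i'" "i' < i" for i'
      using that less by auto
    then have "f i = g i - (r i + (\<Sum>i'<i. append_sym C (i - i') (h i')))"
      using less.prems by (subst f_rec, subst S) auto
    also have "\<dots> = h i"
      using less.prems by (subst h_rec) (simp add: algebra_simps)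
    finally show ?case .
  qed
  show "f i \<in> ?U" if "0 < i" "i < j" for i
    using that by (simp add: fh hU)
  define y where "y = r j + (\<Sum>i<j. append_sym C (j - i) (h i))"
  have yU: "y \<in> ?U"
    unfolding y_def using j(1) by (intro supported_add rU supported_sum append_sym_free C hU) auto
  have fj: "f j = Poly_Mapping.single ((A, j) # w) 1 - y"
  proof -
    have "f j = g j - y"
      unfolding y_def using j(1) fh by (subst f_rec, subst S) auto
    then show ?thesis
      using j(1,2) by (simp add: g_def append_sym_word_def)
  qed
  show "f j - Poly_Mapping.single ((A, j) # w) 1 \<in> ?U"
  proof -
    have "f j - Poly_Mapping.single ((A, j) # w) 1 = 0 - y"
      by (simp add: fj)
    then show ?thesis
      using supported_diff[OF supported_0 yU] by (simp only:)
  qed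
  have "f (j + k) = 0" if "0 < k" for k
    using that
  proof (induction k rule: less_induct)
    case (less k)
    have "(\<Sum>i<j+k. sym_act C (j + k - i) (f i)) = (\<Sum>i\<in>{..<Suc j}. sym_act C (j + k - i) (f i))"
    proof (intro sum.mono_neutral_right ballI)
      fix i assume "i \<in> {..<j + k} - {..<Suc j}"
      then have "f i = 0"
        using less.IH[of "i - j"] by auto
      then show "sym_act C (j + k - i) (f i) = 0" by simp
    qed (use less.prems in auto)
    also have "\<dots> = (\<Sum>i<j. sym_act C (j + k - i) (f i)) + sym_act C k (f j)"
      by simp
    finally have *: "f (j + k) = g (j + k) - ((\<Sum>i<j. sym_act C (j + k - i) (f i)) + sym_act C k (f j))"
      by (subst f_rec) simp
    show ?case
    proof (cases "k \<le> card C")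
      case False
      then have "(\<Sum>i<j. sym_act C (j + k - i) (f i)) = 0" "sym_act C k (f j) = 0" "g (j + k) = 0"
        using j(1,4) by (auto simp: g_def append_sym_word_def intro!: sum.neutral)
      then show ?thesis by (simp add: *)
    next
      case True
      have "sym_act C k (f j) = sym_act_word C ((A, j) # w) k - append_sym C k y"
        by (simp add: fj sym_act_diff sym_act_eq_append[OF yU])
      also have "sym_act_word C ((A, j) # w) k =
          g (j + k) - r (j + k) - (\<Sum>i<j. append_sym C (j + k - i) (h i)) + append_sym C k y"
        using True less.prems C(3) j(1,2,3) unfolding y_def
        by (simp add: sym_act_word.simps(2) Let_def h_eq[symmetric] g_def r_def)
      finally show ?thesis
        using j(1) fh by (simp add: * S algebra_simps)
    qed
  qed
  then show "i > j \<Longrightarrow> f i = 0"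
    using less_imp_add_positive by blast
qed

text \<open>The series \<open>x E\<^sub>A E\<^sub>C\<^bsup>-1\<^esup>\<close> has degree at most \<open>|A| - |C|\<close>.\<close>
definition degree_bounded :: "nat set \<Rightarrow> nat set \<Rightarrow> (letter list \<Rightarrow>\<^sub>0 'k::field) \<Rightarrow> bool" where
  "degree_bounded A C x \<longleftrightarrow> (\<forall>i>card A - card C. series_quotient (sym_act C) (\<lambda>m. sym_act A m x) i = 0)"

lemma degree_bounded_add: "degree_bounded A C x \<Longrightarrow> degree_bounded A C y \<Longrightarrow> degree_bounded A C (x + y)"
  by (simp add: degree_bounded_def sym_act_add series_quotient_add)

lemma degree_bounded_0: "degree_bounded A C 0"
  by (simp add: degree_bounded_def series_quotient_zero)

lemma degree_bounded_scal:
  assumes "degree_bounded A C x"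
  shows "degree_bounded A C (scal c x)"
proof -
  have "series_quotient (sym_act C) (\<lambda>m. sym_act A m (scal c x)) i = scal c (series_quotient (sym_act C) (\<lambda>m. sym_act A m x) i)" for i
  proof (induction i rule: less_induct)
    case (less i)
    then show ?case
      by (simp add: series_quotient.simps[of _ _ i] sym_act_scal words.scale_right_diff_distrib words.scale_sum_right)
  qed
  then show ?thesis
    using assms by (simp add: degree_bounded_def)
qed

lemma degree_bounded_supported:
  fixes x :: "letter list \<Rightarrow>\<^sub>0 'k::field"
  assumes "x \<in> supported S"
    and "\<And>w. w \<in> S \<Longrightarrow> degree_bounded A C (Poly_Mapping.single w 1 :: _ \<Rightarrow>\<^sub>0 'k)"
  shows "degree_bounded A C x"
proof -
  have "degree_bounded A C (\<Sum>w\<in>K. scal (Poly_Mapping.lookup x w) (Poly_Mapping.single w 1))"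
    if "finite K" "K \<subseteq> S" for K
    using that
  proof (induction K)
    case (insert w K)
    then have "degree_bounded A C (Poly_Mapping.single w 1 :: _ \<Rightarrow>\<^sub>0 'k)"
      using insert.prems by (intro assms(2)) auto
    then show ?case
      unfolding sum.insert[OF insert.hyps] using insert by (intro degree_bounded_add degree_bounded_scal) auto
  qed (simp add: degree_bounded_0)
  from this[of "Poly_Mapping.keys x"] show ?thesis
    using assms(1) word_expansion[of x] by (simp add: supported_def)
qed

lemma degree_bounded_free:
  assumes "A \<subseteq> {1..n}" "C \<subset> A" "w \<in> free_words n A"
  shows "degree_bounded A C (Poly_Mapping.single w 1 :: _ \<Rightarrow>\<^sub>0 'k::field)"
  by (simp add: degree_bounded_def free_words_quotient(4)[OF assms])

text \<open>Induction on the length of \<open>w\<close>. The only new case is \<open>w = (B, b) # u\<close> with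
  \<open>A \<subseteq> B\<close> and \<open>|A| = |B| - b\<close>. Let \<open>F\<close> be the quotient of \<open>u E\<^sub>B\<close> by \<open>E\<^sub>A\<close>. It has degree at most \<open>b\<close>,
  and its top coefficient is \<open>w\<close> up to words that \<open>A\<close> may follow. Now
  \<open>u E\<^sub>B E\<^sub>C\<^bsup>-1\<^esup> = \<Sum>\<^sub>i s\<^sup>i F\<^sub>i E\<^sub>A E\<^sub>C\<^bsup>-1\<^esup>\<close>. The left side has degree at most
  \<open>b + |A| - |C|\<close>, and so have the terms with \<open>i < b\<close>: the coefficient \<open>F\<^sub>0 = u\<close> is shorter than
  \<open>w\<close>, and the other \<open>F\<^sub>i\<close> consist of words that \<open>A\<close> may follow. Hence the bound holds for \<open>F\<^sub>b\<close>,
  and with it for \<open>w\<close>.\<close>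
lemma degree_bounded_normal:
  assumes "normal_word n w" and A: "A \<subseteq> {1..n}" and CA: "C \<subset> A"
  shows "degree_bounded A C (Poly_Mapping.single w 1 :: _ \<Rightarrow>\<^sub>0 'k::field)"
  using assms(1)
proof (induction w)
  case Nil
  show ?case by (rule degree_bounded_free[OF A CA]) (simp add: free_words_def)
next
  case (Cons a u)
  obtain B b where a: "a = (B, b)" by force
  show ?case
  proof (cases "blocked (a # u) A")
    case False
    then show ?thesis
      using Cons.prems by (intro degree_bounded_free[OF A CA]) (simp add: free_words_def)
  next
    case True
    have B: "B \<subseteq> {1..n}" "1 \<le> b" "b \<le> card B" "u \<in> free_words n B" "normal_word n u"
      using Cons.prems by (auto simp: a free_words_def)
    have AB: "A \<subseteq> B" "card A = card B - b"
      using True by (auto simp: a)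
    have "A \<noteq> B" using AB B by auto
    then have AB': "A \<subset> B" "C \<subset> B" using AB CA by auto
    have card: "card C \<le> card A"
      using CA finite_subset[OF A] by (intro card_mono) auto
    have b: "card B - card A = b" and bC: "card B - card C = b + (card A - card C)"
      using AB B card by auto
    define g where "g = (\<lambda>m. sym_act_word B u m :: _ \<Rightarrow>\<^sub>0 'k)"
    define F where "F = series_quotient (sym_act A) g"
    note Fq = free_words_quotient[OF B(1) AB'(1) B(4), where 'k = 'k, unfolded b, folded g_def, folded F_def]
    note Gq = free_words_quotient(4)[OF B(1) AB'(2) B(4), where 'k = 'k, unfolded bC, folded g_def]
    have free: "degree_bounded A C x" if "x \<in> supported (free_words n A)" for x :: "_ \<Rightarrow>\<^sub>0 'k"
      using that by (rule degree_bounded_supported) (rule degree_bounded_free[OF A CA])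
    have Fi: "degree_bounded A C (F i)" if "i < b" for i
      using Fq(1,2) Cons.IH[OF B(5)] that free by (cases "i = 0") auto
    let ?q = "\<lambda>x. series_quotient (sym_act C) (\<lambda>m. sym_act A m x)"
    have g_eq: "g m = (\<Sum>i\<le>b. if m < i then 0 else sym_act A (m - i) (F i))" for m
    proof -
      have "g m = (\<Sum>i\<le>m. sym_act A (m - i) (F i))"
        unfolding F_def by (simp add: sum_series_quotient)
      also have "\<dots> = (\<Sum>i\<in>{..m} \<union> {..b}. if m < i then 0 else sym_act A (m - i) (F i))"
        by (intro sum.mono_neutral_cong_left) auto
      also have "\<dots> = (\<Sum>i\<le>b. if m < i then 0 else sym_act A (m - i) (F i))"
        by (intro sum.mono_neutral_right) (auto simp: Fq(4))
      finally show ?thesis .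
    qed
    have q_eq: "series_quotient (sym_act C) g k = (\<Sum>i\<le>b. if k < i then 0 else ?q (F i) (k - i))" for k
    proof -
      have "series_quotient (sym_act C) g k
          = series_quotient (sym_act C) (\<lambda>m. \<Sum>i\<le>b. if m < i then 0 else sym_act A (m - i) (F i)) k"
        by (intro series_quotient_cong g_eq)
      also have "\<dots> = (\<Sum>i\<le>b. if k < i then 0 else ?q (F i) (k - i))"
        by (simp add: series_quotient_sum sym_act_add series_quotient_shift[where E = "sym_act C" and g = "\<lambda>m. sym_act A m (F _)"])
      finally show ?thesis .
    qed
    have "?q (F b) i = 0" if i: "i > card A - card C" for i
    proof -
      have "0 = series_quotient (sym_act C) g (b + i)"
        using Gq i by simp
      also have "\<dots> = (\<Sum>i'<b. ?q (F i') (b + i - i')) + ?q (F b) i"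
        by (simp add: q_eq flip: lessThan_Suc_atMost)
      also have "(\<Sum>i'<b. ?q (F i') (b + i - i')) = 0"
        using Fi i by (intro sum.neutral) (auto simp: degree_bounded_def)
      finally show ?thesis by simp
    qed
    then have "degree_bounded A C (F b)"
      by (simp add: degree_bounded_def)
    (* F b and w differ by words that A may follow. *)
    moreover have "degree_bounded A C (scal (- 1) (F b - Poly_Mapping.single (a # u) 1))"
      using Fq(3) by (intro free supported_scal) (simp add: a)
    ultimately have "degree_bounded A C (F b + scal (- 1) (F b - Poly_Mapping.single (a # u) 1))"
      by (rule degree_bounded_add)
    then show ?thesis by simp
  qed
qed

definition normal_span :: "nat \<Rightarrow> (letter list \<Rightarrow>\<^sub>0 'k::field) set" where
  "normal_span n = supported {w. normal_word n w}"

lemma sym_act_normal_span: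
  assumes "x \<in> normal_span n" "C \<subseteq> {1..n}"
  shows "sym_act C k x \<in> normal_span n"
proof (cases "k = 0")
  case False
  have "sym_act_word C w k \<in> supported {w. normal_word n w}" if "normal_word n w" for w
    by (rule supported_mono[OF sym_act_word_into_free[OF that assms(2)]])
      (use False in \<open>auto simp: free_words_def\<close>)
  then show ?thesis
    using assms(1) unfolding normal_span_def sym_act_def by (elim supported_lin_ext) auto
qed (use assms in simp)

text \<open>For \<open>|A| = |C| + 1\<close> the quotient \<open>E\<^sub>A E\<^sub>C\<^bsup>-1\<^esup>\<close> is \<open>1 + z s\<close> with \<open>z = e\<^sub>1(A) - e\<^sub>1(C)\<close>, and the
  vanishing of its coefficient of degree 2 is the identity \<open>z e\<^sub>1(C) = e\<^sub>2(A) - e\<^sub>2(C)\<close>.\<close>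
lemma second_symmetric_relation:
  assumes x: "x \<in> normal_span n" and A: "insert i C \<subseteq> {1..n}" and i: "i \<notin> C"
  shows "sym_act C 1 (sym_act (insert i C) 1 x - sym_act C 1 x) = sym_act (insert i C) 2 x - sym_act C 2 x"
proof -
  have "finite C" using finite_subset[OF A] by auto
  have "degree_bounded (insert i C) C x"
    using x A i unfolding normal_span_def
    by (elim degree_bounded_supported) (auto intro!: degree_bounded_normal)
  then have 2: "series_quotient (sym_act C) (\<lambda>m. sym_act (insert i C) m x) 2 = 0"
    using i \<open>finite C\<close> by (simp add: degree_bounded_def)
  define q where "q = series_quotient (sym_act C) (\<lambda>m. sym_act (insert i C) m x)"
  have q: "q m = sym_act (insert i C) m x - (\<Sum>i<m. sym_act C (m - i) (q i))" for m
    unfolding q_def by (rule series_quotient.simps)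
  have q0: "q 0 = x" and q1: "q 1 = sym_act (insert i C) 1 x - sym_act C 1 x"
    using q[of 0] q[of 1] by simp_all
  have "{..<2::nat} = {0, 1}" by auto
  then have "q 2 = sym_act (insert i C) 2 x - (sym_act C 2 x + sym_act C 1 (q 1))"
    using q[of 2] q0 by simp
  with 2 have "sym_act C 1 (q 1) = sym_act (insert i C) 2 x - sym_act C 2 x"
    unfolding q_def[symmetric] by (metis add.commute add_diff_cancel_right' eq_iff_diff_eq_0)
  then show ?thesis unfolding q1 .
qed

section \<open>Weights and leading words\<close>

text \<open>The weight \<open>a + (a - 1) + \<dots> + (a - j + 1)\<close> of \<open>r(A:j)\<close>, where \<open>a = |A|\<close>.\<close>
definition descent_weight :: "nat \<Rightarrow> nat \<Rightarrow> nat" where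
  "descent_weight a j = (\<Sum>l<j. a - l)"

lemma descent_weight_simps [simp]:
  "descent_weight a 0 = 0"
  "descent_weight a (Suc 0) = a"
  by (simp_all add: descent_weight_def)

lemma descent_weight_add: "descent_weight a (j + k) = descent_weight a j + descent_weight (a - j) k"
  by (induction k) (simp_all add: descent_weight_def)

lemma descent_weight_mono: "a \<le> b \<Longrightarrow> descent_weight a k \<le> descent_weight b k"
  unfolding descent_weight_def by (intro sum_mono) auto

lemma descent_weight_strict_mono:
  assumes "a < b" "0 < k"
  shows "descent_weight a k < descent_weight b k"
proof -
  obtain k' where k: "k = 1 + k'" using \<open>0 < k\<close> by (metis Suc_pred' plus_1_eq_Suc)
  have "descent_weight (a - 1) k' \<le> descent_weight (b - 1) k'"
    using assms by (intro descent_weight_mono) auto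
  then show ?thesis
    using assms by (simp only: k descent_weight_add) simp
qed

definition word_weight :: "letter list \<Rightarrow> nat" where
  "word_weight w = (\<Sum>(A, j)\<leftarrow>w. descent_weight (card A) j)"

lemma word_weight_simps [simp]:
  "word_weight [] = 0"
  "word_weight ((A, j) # w) = descent_weight (card A) j + word_weight w"
  by (simp_all add: word_weight_def)

definition light :: "nat \<Rightarrow> (letter list \<Rightarrow>\<^sub>0 'k::field) set" where
  "light m = supported {w. word_weight w < m}"

lemma light_single [simp]: "Poly_Mapping.single w 1 \<in> light m \<longleftrightarrow> word_weight w < m"
  by (simp add: light_def)

lemma light_mono: "x \<in> light m \<Longrightarrow> m \<le> m' \<Longrightarrow> x \<in> light m'"
  unfolding light_def by (erule supported_mono) auto

lemma light_add: "x \<in> light m \<Longrightarrow> y \<in> light m \<Longrightarrow> x + y \<in> light m"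
  and light_diff: "x \<in> light m \<Longrightarrow> y \<in> light m \<Longrightarrow> x - y \<in> light m"
  and light_sum: "(\<And>i. i \<in> I \<Longrightarrow> f i \<in> light m) \<Longrightarrow> sum f I \<in> light m"
  and light_0 [simp]: "0 \<in> light m"
  by (auto simp: light_def intro: supported_add supported_diff supported_sum)

lemma append_sym_word_light: "(append_sym_word C k w :: _ \<Rightarrow>\<^sub>0 'k::field) \<in> light (Suc (word_weight w + descent_weight (card C) k))"
  by (simp add: append_sym_word_def)

lemma append_sym_light:
  assumes "x \<in> light m" "m + descent_weight (card C) k \<le> m'"
  shows "append_sym C k x \<in> light m'"
  using assms(1) unfolding light_def
proof (rule supported_lin_ext)
  fix w assume "w \<in> {w. word_weight w < m}"
  then have "append_sym_word C k w \<in> light m'"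
    using assms(2) by (intro light_mono[OF append_sym_word_light]) auto
  then show "append_sym_word C k w \<in> supported {w. word_weight w < m'}"
    by (simp add: light_def)
qed

text \<open>In the formula for a forbidden product every term except \<open>(A, j + k)\<close> arises from \<open>u e\<^sub>i(A)\<close>,
  \<open>i < j\<close>, by multiplication with one or two elements \<open>e\<^sub>l(C)\<close> of total degree \<open>j + k - i\<close>. In
  \<open>e\<^bsub>j+k\<^esub>(A)\<close> the stretch that they replace contributes the sizes \<open>|A| - i, |A| - i - 1, \<dots>\<close> to the weight.
  Each \<open>e\<^sub>l(C)\<close> is at most as heavy as its part of that stretch, and the first one is lighter because
  its sizes start with \<open>|C| < |A| - i\<close>.\<close>
lemma sym_act_word_blocked:
  assumes A: "A \<subseteq> {1..n}" "1 \<le> j" "j \<le> card A"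
    and C: "C \<subseteq> A" "card C = card A - j"
    and k: "1 \<le> k" "k \<le> card C"
    and u: "\<And>m. (sym_act_word C u m :: _ \<Rightarrow>\<^sub>0 'k::field) \<in> light (Suc (word_weight u + descent_weight (card C) m))"
  shows "sym_act_word C ((A, j) # u) k - Poly_Mapping.single ((A, j + k) # u) (1 :: 'k)
    \<in> light (word_weight ((A, j + k) # u))"
proof -
  let ?a = "card A" and ?c = "card C" and ?W = "word_weight u"
  define f where "f = series_quotient (append_sym C) (\<lambda>m. if m = 0 then 0 else append_sym_word A m u - (sym_act_word C u m :: _ \<Rightarrow>\<^sub>0 'k))"
  have f_rec: "f m = (if m = 0 then 0 else append_sym_word A m u - sym_act_word C u m) - (\<Sum>i<m. append_sym C (m - i) (f i))" for m
    unfolding f_def by (rule series_quotient.simps)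
  have ca: "?c < ?a" using C A by auto
  have le: "descent_weight ?a i + descent_weight ?c m \<le> descent_weight ?a (i + m)" if "i \<le> j" for i m
    using that C(2) by (simp add: descent_weight_add descent_weight_mono)
  have less: "descent_weight ?a i + descent_weight ?c m < descent_weight ?a (i + m)" if "i < j" "0 < m" for i m
  proof -
    have "?c < ?a - i" using that C(2) A(3) by auto
    then show ?thesis
      using that by (simp add: descent_weight_add descent_weight_strict_mono)
  qed
  have f: "f i \<in> light (Suc (?W + descent_weight ?a i))" if "i < j" for i
    using that
  proof (induction i rule: less_induct)
    case (less i)
    have 1: "append_sym_word A i u \<in> (light (Suc (?W + descent_weight ?a i)) :: (_ \<Rightarrow>\<^sub>0 'k) set)"
      by (rule append_sym_word_light)
    have 2: "sym_act_word C u i \<in> (light (Suc (?W + descent_weight ?a i)) :: (_ \<Rightarrow>\<^sub>0 'k) set)"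
      using ca by (intro light_mono[OF u]) (simp add: descent_weight_mono)
    have 3: "append_sym C (i - i') (f i') \<in> light (Suc (?W + descent_weight ?a i))" if "i' < i" for i'
      using that less le[of i' "i - i'"] by (intro append_sym_light[OF less.IH]) auto
    show ?case
      by (subst f_rec) (auto intro!: light_diff light_sum 1 2 3)
  qed
  let ?L = "light (?W + descent_weight ?a (j + k)) :: (_ \<Rightarrow>\<^sub>0 'k) set"
  have jk: "descent_weight ?a (j + k) = descent_weight ?a j + descent_weight ?c k"
    using C(2) by (simp add: descent_weight_add)
  have t1: "sym_act_word C u (j + k) \<in> ?L"
    using A less[of 0 "j + k"] by (intro light_mono[OF u]) auto
  have t2: "append_sym C (j + k - i) (f i) \<in> ?L" if "i < j" for i
    using that less[of i "j + k - i"] k by (intro append_sym_light[OF f]) auto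
  have t3: "sym_act_word C u j \<in> (light (?W + descent_weight ?a j) :: (_ \<Rightarrow>\<^sub>0 'k) set)"
    using A less[of 0 j] by (intro light_mono[OF u]) auto
  have t4: "append_sym C (j - i) (f i) \<in> light (?W + descent_weight ?a j)" if "i < j" for i
    using that less[of i "j - i"] by (intro append_sym_light[OF f]) auto
  have t5: "append_sym C k (sym_act_word C u j + (\<Sum>i<j. append_sym C (j - i) (f i))) \<in> ?L"
    by (rule append_sym_light[where m = "?W + descent_weight ?a j"])
      (auto intro!: light_add light_sum t3 t4 simp: jk)
  have "sym_act_word C ((A, j) # u) k = append_sym_word A (j + k) u - sym_act_word C u (j + k)
      - (\<Sum>i<j. append_sym C (j + k - i) (f i)) + append_sym C k (sym_act_word C u j + (\<Sum>i<j. append_sym C (j - i) (f i)))"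
    using k C by (simp add: sym_act_word.simps(2) Let_def f_def)
  moreover have "append_sym_word A (j + k) u = Poly_Mapping.single ((A, j + k) # u) (1 :: 'k)"
  proof -
    have "j + k \<le> card A" using k C A by linarith
    then show ?thesis using k by (simp add: append_sym_word_def)
  qed
  ultimately have "sym_act_word C ((A, j) # u) k - Poly_Mapping.single ((A, j + k) # u) (1 :: 'k)
      = append_sym C k (sym_act_word C u j + (\<Sum>i<j. append_sym C (j - i) (f i)))
        - (sym_act_word C u (j + k) + (\<Sum>i<j. append_sym C (j + k - i) (f i)))"
    by simp
  also have "\<dots> \<in> ?L"
    by (intro light_diff t5 light_add t1 light_sum t2) auto
  finally show ?thesis by (simp add: add.commute)
qed

lemma sym_act_word_light:
  assumes "normal_word n w"
  shows "(sym_act_word C w k :: _ \<Rightarrow>\<^sub>0 'k::field) \<in> light (Suc (word_weight w + descent_weight (card C) k))"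
  using assms
proof (induction w arbitrary: k)
  case Nil
  then show ?case using append_sym_word_light[of C k "[]"] by simp
next
  case (Cons a u)
  obtain A j where a: "a = (A, j)" by force
  show ?case
  proof (cases "k = 0 \<or> k > card C \<or> \<not> blocked (a # u) C")
    case True
    then show ?thesis using append_sym_word_light[of C k "a # u"] by (auto simp: sym_act_word_unblocked)
  next
    case False
    then have C: "C \<subseteq> A" "card C = card A - j" by (auto simp: a)
    have A: "A \<subseteq> {1..n}" "1 \<le> j" "j \<le> card A" and u: "normal_word n u"
      using Cons.prems by (auto simp: a)
    have w: "word_weight ((A, j + k) # u) = word_weight (a # u) + descent_weight (card C) k"
      using C by (simp add: a descent_weight_add)
    have "sym_act_word C ((A, j) # u) k - Poly_Mapping.single ((A, j + k) # u) (1 :: 'k)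
        \<in> light (word_weight ((A, j + k) # u))"
      using False by (intro sym_act_word_blocked[OF A C] Cons.IH[OF u]) auto
    then have "sym_act_word C ((A, j) # u) k - Poly_Mapping.single ((A, j + k) # u) (1 :: 'k)
        + Poly_Mapping.single ((A, j + k) # u) 1 \<in> light (Suc (word_weight ((A, j + k) # u)))"
      by (rule light_add[OF light_mono]) simp_all
    then show ?thesis
      unfolding w by (simp add: a)
  qed
qed

lemma sym_act_light:
  fixes x :: "letter list \<Rightarrow>\<^sub>0 'k::field"
  assumes "x \<in> light m" "x \<in> normal_span n"
  shows "sym_act C k x \<in> light (m + descent_weight (card C) k)"
proof -
  have "x \<in> supported {w. normal_word n w \<and> word_weight w < m}"
    using assms by (auto simp: light_def normal_span_def supported_def)
  then have "sym_act C k x \<in> supported {w. word_weight w < m + descent_weight (card C) k}"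
    unfolding sym_act_def
  proof (rule supported_lin_ext)
    fix w assume w: "w \<in> {w. normal_word n w \<and> word_weight w < m}"
    then have "(sym_act_word C w k :: _ \<Rightarrow>\<^sub>0 'k) \<in> light (m + descent_weight (card C) k)"
      by (intro light_mono[OF sym_act_word_light[of n w C k]]) auto
    then show "(sym_act_word C w k :: _ \<Rightarrow>\<^sub>0 'k) \<in> supported {w. word_weight w < m + descent_weight (card C) k}"
      by (simp add: light_def)
  qed
  then show ?thesis by (simp add: light_def)
qed

definition has_leading_word :: "nat \<Rightarrow> letter list \<Rightarrow> (letter list \<Rightarrow>\<^sub>0 'k::field) \<Rightarrow> bool" where
  "has_leading_word n w x \<longleftrightarrow> normal_word n w \<and> x \<in> normal_span n \<and> x - Poly_Mapping.single w 1 \<in> light (word_weight w)"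

lemma has_leading_word_act:
  fixes x :: "letter list \<Rightarrow>\<^sub>0 'k::field"
  assumes x: "has_leading_word n w x" and C: "C \<subseteq> {1..n}" and v: "normal_word n v"
    and vw: "word_weight v = word_weight w + card C"
    and step: "sym_act_word C w 1 - Poly_Mapping.single v (1 :: 'k) \<in> light (word_weight v)"
  shows "has_leading_word n v (sym_act C 1 x)"
proof -
  let ?y = "x - Poly_Mapping.single w 1"
  have w: "normal_word n w" "x \<in> normal_span n" "?y \<in> light (word_weight w)"
    using x by (auto simp: has_leading_word_def)
  have "Poly_Mapping.single w 1 \<in> (normal_span n :: (_ \<Rightarrow>\<^sub>0 'k) set)"
    using w(1) by (simp add: normal_span_def)
  then have "?y \<in> normal_span n"
    using w(2) unfolding normal_span_def by (intro supported_diff)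
  then have "sym_act C 1 ?y \<in> light (word_weight v)"
    using sym_act_light[OF w(3), of n C 1] by (simp add: vw)
  from light_add[OF this step] have "sym_act C 1 x - Poly_Mapping.single v 1 \<in> light (word_weight v)"
    by (simp add: sym_act_diff)
  then show ?thesis
    using v sym_act_normal_span[OF w(2) C] by (simp add: has_leading_word_def)
qed

lemma has_leading_word_append:
  fixes x :: "letter list \<Rightarrow>\<^sub>0 'k::field"
  assumes "has_leading_word n w x" "C \<subseteq> {1..n}" "C \<noteq> {}" "\<not> blocked w C"
  shows "has_leading_word n ((C, 1) # w) (sym_act C 1 x)"
proof (rule has_leading_word_act[OF assms(1,2)])
  have "card C > 0"
    using assms(2,3) finite_subset[OF assms(2)] by (simp add: card_gt_0_iff)
  then show "normal_word n ((C, 1) # w)" "sym_act_word C w 1 - Poly_Mapping.single ((C, 1) # w) (1 :: 'k) \<in> light (word_weight ((C, 1) # w))"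
    using assms by (auto simp: has_leading_word_def sym_act_word_unblocked append_sym_word_def)
qed simp

lemma has_leading_word_extend:
  fixes x :: "letter list \<Rightarrow>\<^sub>0 'k::field"
  assumes "has_leading_word n ((A, j) # u) x" "C \<subseteq> A" "card C = card A - j" "C \<noteq> {}"
  shows "has_leading_word n ((A, Suc j) # u) (sym_act C 1 x)"
proof -
  have n: "normal_word n ((A, j) # u)"
    using assms(1) by (simp add: has_leading_word_def)
  then have A: "A \<subseteq> {1..n}" "1 \<le> j" "j \<le> card A" "normal_word n u" "\<not> blocked u A" by auto
  have C: "C \<subseteq> {1..n}" "card C > 0"
    using assms(2,4) A finite_subset[OF A(1)] by (auto simp: card_gt_0_iff finite_subset)
  show ?thesis
  proof (rule has_leading_word_act[OF assms(1) C(1)])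
    show "normal_word n ((A, Suc j) # u)"
      using A C assms(3) by auto
    show "word_weight ((A, Suc j) # u) = word_weight ((A, j) # u) + card C"
      using assms(3) descent_weight_add[of "card A" j 1] by simp
    show "sym_act_word C ((A, j) # u) 1 - Poly_Mapping.single ((A, Suc j) # u) (1 :: 'k) \<in> light (word_weight ((A, Suc j) # u))"
      using sym_act_word_blocked[OF A(1-3) assms(2,3) _ _ sym_act_word_light[OF A(4)], of 1] C by simp
  qed
qed

section \<open>The free algebra acts on the span of the normal words\<close>

text \<open>For maps that are linear without being linear extensions by definition, as the two sides of the
  multiplicativity statements below.\<close>
lemma words_linear_eqI:
  fixes F G :: "('g list \<Rightarrow>\<^sub>0 'k::field) \<Rightarrow> ('h list \<Rightarrow>\<^sub>0 'k)"
  assumes "\<And>x y. F (x + y) = F x + F y" "\<And>c x. F (scal c x) = scal c (F x)"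
    and "\<And>x y. G (x + y) = G x + G y" "\<And>c x. G (scal c x) = scal c (G x)"
    and "\<And>w. F (Poly_Mapping.single w 1) = G (Poly_Mapping.single w 1)"
  shows "F x = G x"
proof -
  have 0: "F 0 = 0" "G 0 = 0"
    using assms(2,4)[of 0 0] by simp_all
  have "F (\<Sum>w\<in>K. scal (Poly_Mapping.lookup x w) (Poly_Mapping.single w 1))
      = G (\<Sum>w\<in>K. scal (Poly_Mapping.lookup x w) (Poly_Mapping.single w 1))" for K
    by (induction K rule: infinite_finite_induct) (simp_all add: 0 assms)
  then show ?thesis
    by (subst (1 2) word_expansion)
qed

lemma single_mult_single_words [simp]:
  "Poly_Mapping.single v (1::'k::field) * Poly_Mapping.single w 1 = Poly_Mapping.single (v @ w) 1"
  by (simp add: mult_single plus_list_def)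

lemma scal_mult: "scal c p * q = scal c (p * q)"
  by (simp add: scal_def mult.assoc)

lemma mult_scal: "p * scal c q = scal c (p * q)"
proof -
  have comm: "p * Poly_Mapping.single [] c = scal c p" for p :: "'a list \<Rightarrow>\<^sub>0 'b::field"
    by (rule words_linear_eqI[where F = "\<lambda>p. p * Poly_Mapping.single [] c"])
      (simp_all add: distrib_right scal_mult words.scale_right_distrib words.scale_left_commute,
       simp add: scal_def mult_single plus_list_def)
  show ?thesis
    unfolding scal_def[of c q] by (simp add: comm scal_mult flip: mult.assoc)
qed

text \<open>The generator \<open>z\<^bsub>A,i\<^esub>\<close> equals \<open>r(A \<union> {i}) - r(A)\<close> in \<open>Q\<^sub>n\<close>, and \<open>r(A) = e\<^sub>1(A)\<close>.\<close>
definition gen_act :: "nat set \<times> nat \<Rightarrow> (letter list \<Rightarrow>\<^sub>0 'k::field) \<Rightarrow> (letter list \<Rightarrow>\<^sub>0 'k)" where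
  "gen_act = (\<lambda>(A, i) x. sym_act (insert i A) 1 x - sym_act A 1 x)"

definition alg_act :: "((nat set \<times> nat) list \<Rightarrow>\<^sub>0 'k::field) \<Rightarrow> (letter list \<Rightarrow>\<^sub>0 'k) \<Rightarrow> (letter list \<Rightarrow>\<^sub>0 'k)" where
  "alg_act p x = lin_ext (\<lambda>w. fold gen_act w x) p"

lemma gen_act_add: "gen_act g (x + y) = gen_act g x + gen_act g y"
  by (simp add: gen_act_def sym_act_add split: prod.split)

lemma gen_act_scal: "gen_act g (scal c x) = scal c (gen_act g x)"
  by (simp add: gen_act_def sym_act_scal words.scale_right_diff_distrib split: prod.split)

lemma fold_gen_act_add: "fold gen_act w (x + y) = fold gen_act w x + fold gen_act w y"
  by (induction w arbitrary: x y) (simp_all add: gen_act_add)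

lemma fold_gen_act_scal: "fold gen_act w (scal c x) = scal c (fold gen_act w x)"
  by (induction w arbitrary: x) (simp_all add: gen_act_scal)

lemma alg_act_add: "alg_act p (x + y) = alg_act p x + alg_act p y"
  by (simp add: alg_act_def lin_ext_def fold_gen_act_add words.scale_right_distrib sum.distrib)

lemma alg_act_scal: "alg_act p (scal c x) = scal c (alg_act p x)"
  by (simp add: alg_act_def lin_ext_def fold_gen_act_scal words.scale_sum_right mult.commute)

lemma alg_act_add_left: "alg_act (p + q) x = alg_act p x + alg_act q x"
  by (simp add: alg_act_def lin_ext_add)

lemma alg_act_diff_left: "alg_act (p - q) x = alg_act p x - alg_act q x"
  by (simp add: alg_act_def lin_ext_diff)

lemma alg_act_scal_left: "alg_act (scal c p) x = scal c (alg_act p x)"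
  by (simp add: alg_act_def lin_ext_scal)

lemma alg_act_single [simp]: "alg_act (Poly_Mapping.single w 1) x = fold gen_act w x"
  by (simp add: alg_act_def)

lemma alg_act_0_left [simp]: "alg_act 0 x = 0"
  by (simp add: alg_act_def)

lemma alg_act_0_right [simp]: "alg_act p 0 = 0"
  using alg_act_scal[of p 0 0] by simp

lemma alg_act_free_gen [simp]: "alg_act (free_gen (A, i)) x = sym_act (insert i A) 1 x - sym_act A 1 x"
  by (simp add: free_gen_def gen_act_def)

lemma alg_act_1 [simp]: "alg_act 1 (x :: letter list \<Rightarrow>\<^sub>0 'k::field) = x"
proof -
  have "(1 :: (nat set \<times> nat) list \<Rightarrow>\<^sub>0 'k) = Poly_Mapping.single [] 1"
    using single_one by (metis zero_list_def)
  then show ?thesis by (metis alg_act_single fold_simps(1))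
qed

text \<open>The order is reversed because functions are written on the left of their argument, while the
  algebra acts from the right.\<close>
lemma alg_act_mult: "alg_act (p * q) x = alg_act q (alg_act p x)"
proof (rule words_linear_eqI[where F = "\<lambda>p. alg_act (p * q) x" and G = "\<lambda>p. alg_act q (alg_act p x)"])
  show "alg_act (Poly_Mapping.single v 1 * q) x = alg_act q (alg_act (Poly_Mapping.single v 1) x)" for v
    by (rule words_linear_eqI[where F = "\<lambda>q. alg_act (Poly_Mapping.single v 1 * q) x"])
      (simp_all add: distrib_left mult_scal alg_act_add_left alg_act_scal_left)
qed (simp_all add: distrib_right scal_mult alg_act_add_left alg_act_scal_left alg_act_add alg_act_scal)

lemma alg_act_normal_span:
  assumes "p \<in> supported (lists (gens n))" "x \<in> normal_span n"
  shows "alg_act p x \<in> normal_span n"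
proof -
  have gen: "gen_act g x \<in> normal_span n" if "g \<in> gens n" "x \<in> normal_span n" for g and x :: "letter list \<Rightarrow>\<^sub>0 'a"
  proof -
    obtain A i where g: "g = (A, i)" by force
    have "A \<subseteq> {1..n}" "insert i A \<subseteq> {1..n}"
      using that(1) by (auto simp: g gens_def)
    from this[THEN sym_act_normal_span[OF that(2)]] show ?thesis
      by (auto simp: g gen_act_def normal_span_def intro: supported_diff)
  qed
  have "fold gen_act w x \<in> normal_span n" if "w \<in> lists (gens n)" for w
    using that assms(2) by (induction w arbitrary: x) (auto simp: gen)
  then show ?thesis
    using assms(1) unfolding alg_act_def normal_span_def by (elim supported_lin_ext)
qed

lemma a_inv_free_algebra:
  assumes "p \<in> carrier (free_algebra X)"
  shows "\<ominus>\<^bsub>free_algebra X\<^esub> p = - p"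
proof -
  interpret ring "free_algebra X :: ('b, 'a list \<Rightarrow>\<^sub>0 'b::field) module"
    by (rule ring_free_algebra)
  show ?thesis
    using assms by (intro minus_equality) auto
qed

lemma free_gen_supported: "g \<in> gens n \<Longrightarrow> free_gen g \<in> supported (lists (gens n))"
  by (simp add: free_gen_def)

text \<open>With \<open>z = z\<^bsub>A,i\<^esub>\<close> and \<open>z' = z\<^bsub>A \<union> {i},j\<^esub>\<close>, applying the identity for \<open>e\<^sub>2\<close> twice gives
  \<open>z' z = e\<^sub>2(A \<union> {i, j}) - e\<^sub>2(A) - (z' + z) e\<^sub>1(A)\<close>, which is symmetric in \<open>i\<close> and \<open>j\<close> since
  \<open>z' + z = e\<^sub>1(A \<union> {i, j}) - e\<^sub>1(A)\<close>.\<close>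
lemma relators_act:
  assumes p: "p \<in> relators n" and x: "x \<in> normal_span n"
  shows "alg_act p x = 0"
proof -
  obtain A i j where A: "A \<subseteq> {1..n}" "i \<in> {1..n} - A" "j \<in> {1..n} - A" "i \<noteq> j"
    and cases: "p = (free_gen (insert i A, j) + free_gen (A, i)) - (free_gen (insert j A, i) + free_gen (A, j)) \<or>
      p = free_gen (insert i A, j) * free_gen (A, i) - free_gen (insert j A, i) * free_gen (A, j)"
    using p unfolding relators_def by blast
  have two_steps: "alg_act (free_gen (insert i A, j) * free_gen (A, i)) x
      = sym_act (insert j (insert i A)) 2 x - sym_act A 1 (sym_act (insert j (insert i A)) 1 x)
        + sym_act A 1 (sym_act A 1 x) - sym_act A 2 x"
    if "i \<in> {1..n} - A" "j \<in> {1..n} - A" "i \<noteq> j" for i j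
  proof -
    let ?B = "insert i A"
    have B: "?B \<subseteq> {1..n}" "insert j ?B \<subseteq> {1..n}" "j \<notin> ?B" "i \<notin> A"
      using A that by auto
    have "alg_act (free_gen (?B, j) * free_gen (A, i)) x
        = sym_act ?B 1 (sym_act (insert j ?B) 1 x - sym_act ?B 1 x)
          - (sym_act A 1 (sym_act (insert j ?B) 1 x) - sym_act A 1 (sym_act ?B 1 x))"
      by (simp add: alg_act_mult sym_act_diff)
    also have "sym_act ?B 1 (sym_act (insert j ?B) 1 x - sym_act ?B 1 x) = sym_act (insert j ?B) 2 x - sym_act ?B 2 x"
      by (rule second_symmetric_relation[OF x B(2,3)])
    also have "sym_act A 1 (sym_act ?B 1 x) = sym_act ?B 2 x - sym_act A 2 x + sym_act A 1 (sym_act A 1 x)"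
      using second_symmetric_relation[OF x B(1,4)] unfolding sym_act_diff by (simp add: algebra_simps)
    finally show ?thesis by simp
  qed
  from cases show ?thesis
  proof
    assume "p = (free_gen (insert i A, j) + free_gen (A, i)) - (free_gen (insert j A, i) + free_gen (A, j))"
    then show ?thesis
      by (simp add: alg_act_add_left alg_act_diff_left insert_commute)
  next
    assume "p = free_gen (insert i A, j) * free_gen (A, i) - free_gen (insert j A, i) * free_gen (A, j)"
    then show ?thesis
      using two_steps[of i j] two_steps[of j i] A by (simp add: alg_act_diff_left insert_commute)
  qed
qed

text \<open>The elements of the free algebra that act as zero form a two-sided ideal because
  the span of the normal words is invariant.\<close>
lemma rel_ideal_act:
  fixes p :: "(nat set \<times> nat) list \<Rightarrow>\<^sub>0 'k::field"
  assumes p: "p \<in> rel_ideal n" and x: "x \<in> normal_span n"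
  shows "alg_act p x = 0"
proof -
  let ?F = "free_Q n :: ('k, _) module"
  define K where "K = {p \<in> carrier ?F. \<forall>x\<in>normal_span n. alg_act p x = 0}"
  interpret ring ?F by (rule ring_free_algebra)
  have "ideal K ?F"
  proof (rule idealI[OF ring_axioms])
    show "subgroup K (add_monoid ?F)"
    proof (rule add.subgroupI)
      have "0 \<in> K" by (simp add: K_def)
      then show "K \<noteq> {}" by blast
      fix a assume a: "a \<in> K"
      show "\<ominus>\<^bsub>?F\<^esub> a \<in> K"
        using a a_inv_closed[of a] alg_act_diff_left[of 0 a]
        unfolding K_def by (auto simp: a_inv_free_algebra simp del: free_algebra_simps(1))
      fix b assume b: "b \<in> K"
      show "a \<oplus>\<^bsub>?F\<^esub> b \<in> K"
        using a b a_closed[of a b] unfolding K_def by (auto simp: alg_act_add_left simp del: free_algebra_simps(1))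
    qed (auto simp: K_def)
  next
    fix a q assume a: "a \<in> K" and q: "q \<in> carrier ?F"
    have "alg_act q y \<in> normal_span n" if "y \<in> normal_span n" for y
      using q that by (intro alg_act_normal_span) (simp_all add: supported_def)
    then show "q \<otimes>\<^bsub>?F\<^esub> a \<in> K" "a \<otimes>\<^bsub>?F\<^esub> q \<in> K"
      using a q m_closed[of q a] m_closed[of a q] unfolding K_def
      by (auto simp: alg_act_mult simp del: free_algebra_simps(1))
  qed
  moreover have "relators n \<subseteq> K"
    using relators_closed[of n] relators_act by (auto simp: K_def)
  ultimately have "rel_ideal n \<subseteq> K"
    unfolding rel_ideal_def by (rule genideal_minimal)
  then show ?thesis
    using p x by (auto simp: K_def)
qed

section \<open>The leading word of an admissible product\<close>

lemma drop_largest_eq: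
  assumes "finite A"
  shows "drop_largest l A = set (take (card A - l) (sorted_list_of_set A))"
proof -
  let ?s = "sorted_list_of_set A"
  have "set (take l (rev ?s)) = set (drop (card A - l) ?s)"
    by (simp add: take_rev)
  moreover have "A = set (take (card A - l) ?s) \<union> set (drop (card A - l) ?s)"
    using assms by (metis append_take_drop_id set_append set_sorted_list_of_set)
  moreover have "set (take (card A - l) ?s) \<inter> set (drop (card A - l) ?s) = {}"
    by (rule set_take_disj_set_drop_if_distinct) simp_all
  ultimately show ?thesis
    unfolding drop_largest_def by blast
qed

lemma sorted_list_drop_largest:
  assumes "finite A"
  shows "sorted_list_of_set (drop_largest l A) = take (card A - l) (sorted_list_of_set A)"
  using assms by (simp add: drop_largest_eq sorted_list_of_set.idem_if_sorted_distinct sorted_wrt_take)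

lemma drop_largest_subset: "drop_largest l A \<subseteq> A"
  by (auto simp: drop_largest_def)

lemma finite_drop_largest: "finite A \<Longrightarrow> finite (drop_largest l A)"
  by (rule finite_subset[OF drop_largest_subset])

lemma card_drop_largest:
  assumes "finite A"
  shows "card (drop_largest l A) = card A - l"
  using arg_cong[OF sorted_list_drop_largest[OF assms], of length l] by simp

lemma drop_largest_0 [simp]: "drop_largest 0 A = A"
  by (simp add: drop_largest_def)

lemma drop_largest_drop_largest:
  assumes "finite A"
  shows "drop_largest l (drop_largest m A) = drop_largest (m + l) A"
proof -
  have "drop_largest l (drop_largest m A)
      = set (take (card (drop_largest m A) - l) (sorted_list_of_set (drop_largest m A)))"
    by (rule drop_largest_eq[OF finite_drop_largest[OF assms]])
  also have "\<dots> = set (take (card A - m - l) (take (card A - m) (sorted_list_of_set A)))"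
    by (simp only: sorted_list_drop_largest[OF assms] card_drop_largest[OF assms])
  also have "\<dots> = drop_largest (m + l) A"
    by (simp add: min_def drop_largest_eq[OF assms])
  finally show ?thesis .
qed

lemma drop_largest_1:
  assumes "finite A" "A \<noteq> {}"
  shows "drop_largest 1 A = A - {Max A}"
proof -
  let ?zs = "sorted_list_of_set (A - {Max A}) @ [Max A]"
  have "sorted ?zs" "distinct ?zs"
    using assms by (auto simp: sorted_append)
  moreover have "set ?zs = A"
    using assms(1) insert_Diff[OF Max_in[OF assms]] by simp
  ultimately have "sorted_list_of_set A = ?zs"
    by (metis sorted_list_of_set.idem_if_sorted_distinct)
  then show ?thesis
    by (simp add: drop_largest_def)
qed

definition descent :: "nat set \<Rightarrow> nat \<Rightarrow> nat set list" where
  "descent A j = map (\<lambda>l. drop_largest l A) [0..<j]"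

text \<open>The product of the \<open>r(A:j)\<close> for the entries \<open>(A, j)\<close> of \<open>ps\<close> is the product of the \<open>r(B)\<close> for the
  entries \<open>B\<close> of this list.\<close>
definition flatten :: "letter list \<Rightarrow> nat set list" where
  "flatten ps = concat (map (\<lambda>(A, j). descent A j) ps)"

lemma admissible_snoc:
  "admissible n (ps @ [(A, j)]) \<longleftrightarrow>
     admissible n ps \<and> A \<subseteq> {1..n} \<and> 1 \<le> j \<and> j \<le> card A \<and> \<not> blocked (rev ps) A"
proof (cases ps rule: rev_cases)
  case Nil
  then show ?thesis by (simp add: admissible_def)
next
  case (snoc qs q)
  obtain B b where q: "q = (B, b)" by force
  let ?P = "\<lambda>ps i. card (fst (ps ! Suc i)) \<noteq> card (fst (ps ! i)) - snd (ps ! i) \<or>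
        \<not> fst (ps ! Suc i) \<subseteq> fst (ps ! i)"
  have "(\<forall>i. Suc i < length (ps @ [(A, j)]) \<longrightarrow> ?P (ps @ [(A, j)]) i)
      \<longleftrightarrow> (\<forall>i. Suc i < length ps \<longrightarrow> ?P ps i) \<and> ?P (ps @ [(A, j)]) (length qs)"
  proof -
    have "?P (ps @ [(A, j)]) i = ?P ps i" if "Suc i < length ps" for i
      using that by (simp add: nth_append)
    moreover have "Suc i < length (ps @ [(A, j)]) \<longleftrightarrow> Suc i < length ps \<or> i = length qs" for i
      by (auto simp: snoc)
    ultimately show ?thesis by metis
  qed
  moreover have "?P (ps @ [(A, j)]) (length qs) \<longleftrightarrow> \<not> blocked (rev ps) A"
    by (auto simp: snoc q nth_append)
  ultimately show ?thesis
    unfolding admissible_def by auto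
qed

text \<open>The factors \<open>r(B)\<close> are applied one at a time. The first factor of \<open>r(A:j)\<close> appends the letter
  \<open>(A, 1)\<close>, as admissibility says that \<open>A\<close> is not blocked; each further one is blocked by
  the letter \<open>(A, i)\<close> reached so far and raises its degree by one.\<close>
lemma has_leading_word_flatten:
  assumes "admissible n ps"
  shows "has_leading_word n (rev ps) (fold (\<lambda>A. sym_act A 1) (flatten ps) (Poly_Mapping.single [] (1 :: 'k::field)))"
  using assms
proof (induction ps rule: rev_induct)
  case Nil
  then show ?case by (simp add: has_leading_word_def flatten_def normal_span_def)
next
  case (snoc p ps)
  obtain A j where p: "p = (A, j)" by force
  have adm: "admissible n ps" and A: "A \<subseteq> {1..n}" "1 \<le> j" "j \<le> card A" "\<not> blocked (rev ps) A"
    using snoc.prems by (auto simp: p admissible_snoc)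
  have fin: "finite A" using A finite_subset by auto
  define x where "x = fold (\<lambda>A. sym_act A 1) (flatten ps) (Poly_Mapping.single [] (1 :: 'k))"
  have "has_leading_word n ((A, i) # rev ps) (fold (\<lambda>A. sym_act A 1) (descent A i) x)" if "1 \<le> i" "i \<le> j" for i
    using that
  proof (induction i rule: nat_induct_at_least)
    case base
    have "A \<noteq> {}" using A by auto
    then show ?case
      using has_leading_word_append[OF snoc.IH[OF adm] A(1) _ A(4)] by (simp add: descent_def x_def)
  next
    case (Suc i)
    have "card (drop_largest i A) > 0"
      using Suc A by (simp add: card_drop_largest fin)
    then have "drop_largest i A \<noteq> {}" by auto
    then have "has_leading_word n ((A, Suc i) # rev ps) (sym_act (drop_largest i A) 1 (fold (\<lambda>A. sym_act A 1) (descent A i) x))"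
      using Suc by (intro has_leading_word_extend) (auto simp: drop_largest_subset card_drop_largest fin)
    then show ?case by (simp add: descent_def)
  qed
  then show ?case
    using A by (simp add: p flatten_def x_def)
qed

section \<open>Lifting to the free algebra\<close>

text \<open>A representative of \<open>r(A)\<close> in the free algebra, and the same sum for an arbitrary ordering
  of \<open>A\<close>. Working with representatives modulo the ideal gives access to the arithmetic of a type class
  of rings.\<close>
definition r_lift_ord :: "nat list \<Rightarrow> ((nat set \<times> nat) list \<Rightarrow>\<^sub>0 'k::field)" where
  "r_lift_ord cs = (\<Sum>l<length cs. free_gen (set (take l cs), cs ! l))"

definition r_lift :: "nat set \<Rightarrow> ((nat set \<times> nat) list \<Rightarrow>\<^sub>0 'k::field)" where
  "r_lift A = r_lift_ord (sorted_list_of_set A)"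

definition r_prod :: "nat set list \<Rightarrow> ((nat set \<times> nat) list \<Rightarrow>\<^sub>0 'k::field)" where
  "r_prod As = prod_list (map r_lift As)"

lemma r_prod_simps [simp]:
  "r_prod [] = 1" "r_prod (A # As) = r_lift A * r_prod As" "r_prod (As @ Bs) = r_prod As * r_prod Bs"
  by (simp_all add: r_prod_def)

lemma r_lift_ord_Nil [simp]: "r_lift_ord [] = 0"
  by (simp add: r_lift_ord_def)

lemma r_lift_ord_snoc [simp]: "r_lift_ord (cs @ [c]) = free_gen (set cs, c) + r_lift_ord cs"
  by (simp add: r_lift_ord_def nth_append add.commute)

lemma alg_act_r_lift:
  assumes "finite A"
  shows "alg_act (r_lift A) x = sym_act A 1 x"
proof -
  have "alg_act (r_lift_ord cs) x = sym_act (set cs) 1 x" for cs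
    by (induction cs rule: rev_induct) (simp_all add: alg_act_add_left)
  then show ?thesis
    using assms by (simp add: r_lift_def)
qed

lemma alg_act_r_prod:
  assumes "\<forall>A\<in>set As. finite A"
  shows "alg_act (r_prod As) x = fold (\<lambda>A. sym_act A 1) As x"
  using assms by (induction As arbitrary: x) (simp_all add: alg_act_mult alg_act_r_lift)

section \<open>Cosets of the relation ideal\<close>

definition coset_of :: "nat \<Rightarrow> ((nat set \<times> nat) list \<Rightarrow>\<^sub>0 'k::field) \<Rightarrow> ((nat set \<times> nat) list \<Rightarrow>\<^sub>0 'k) set" where
  "coset_of n p = rel_ideal n +>\<^bsub>free_Q n\<^esub> p"

abbreviation free_carrier :: "nat \<Rightarrow> ((nat set \<times> nat) list \<Rightarrow>\<^sub>0 'k::field) set" where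
  "free_carrier n \<equiv> supported (lists (gens n))"

lemma free_carrier_mult: "p \<in> free_carrier n \<Longrightarrow> q \<in> free_carrier n \<Longrightarrow> p * q \<in> free_carrier n"
  unfolding supported_def mem_Collect_eq by (rule keys_mult_lists)

lemma free_carrier_1: "1 \<in> free_carrier n"
  by (simp add: supported_def zero_list_def)

context
  fixes n :: nat and I :: "((nat set \<times> nat) list \<Rightarrow>\<^sub>0 'k::field) set"
  defines "I \<equiv> rel_ideal n"
begin

interpretation ideal I "free_Q n :: ('k, _) module"
  unfolding I_def by (rule rel_ideal)

lemma rel_ideal_carrier: "p \<in> I \<Longrightarrow> p \<in> free_carrier n"
  using a_Hcarr by (simp add: supported_def)

lemma rel_ideal_0: "0 \<in> I"
  using additive_subgroup.zero_closed[OF additive_subgroup_axioms] by simp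

lemma rel_ideal_add: "p \<in> I \<Longrightarrow> q \<in> I \<Longrightarrow> p + q \<in> I"
  using additive_subgroup.a_closed[OF additive_subgroup_axioms] by simp

lemma rel_ideal_mult_left: "p \<in> I \<Longrightarrow> q \<in> free_carrier n \<Longrightarrow> q * p \<in> I"
  using I_l_closed[of p q] by (simp add: supported_def)

lemma rel_ideal_mult_right: "p \<in> I \<Longrightarrow> q \<in> free_carrier n \<Longrightarrow> p * q \<in> I"
  using I_r_closed[of p q] by (simp add: supported_def)

lemma rel_ideal_scal: "p \<in> I \<Longrightarrow> scal c p \<in> I"
  unfolding scal_def by (rule rel_ideal_mult_left) (auto simp: supported_def)

lemma rel_ideal_subspace: "words.subspace I"
  by (rule words.subspaceI) (auto intro: rel_ideal_0 rel_ideal_add rel_ideal_scal)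

lemma coset_of_closed: "p \<in> free_carrier n \<Longrightarrow> coset_of n p \<in> carrier (Q_alg n)"
  by (auto simp: coset_of_def Q_alg_def quotient_algebra_simps FactRing_def A_RCOSETS_def' supported_def)

lemma coset_of_carrier: "carrier (Q_alg n :: ('k, _) module) = coset_of n ` free_carrier n"
  by (auto simp: coset_of_def Q_alg_def quotient_algebra_simps FactRing_def A_RCOSETS_def' supported_def)

lemma coset_of_add:
  "p \<in> free_carrier n \<Longrightarrow> q \<in> free_carrier n \<Longrightarrow> coset_of n p \<oplus>\<^bsub>Q_alg n\<^esub> coset_of n q = coset_of n (p + q :: _ \<Rightarrow>\<^sub>0 'k)"
  using a_rcos_sum[of p q]
  by (simp add: coset_of_def Q_alg_def quotient_algebra_simps FactRing_def supported_def I_def)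

lemma coset_of_mult:
  "p \<in> free_carrier n \<Longrightarrow> q \<in> free_carrier n \<Longrightarrow> coset_of n p \<otimes>\<^bsub>Q_alg n\<^esub> coset_of n q = coset_of n (p * q :: _ \<Rightarrow>\<^sub>0 'k)"
  using rcoset_mult_add[of p q]
  by (simp add: coset_of_def Q_alg_def quotient_algebra_simps FactRing_def supported_def I_def)

lemma coset_of_smult:
  "p \<in> free_carrier n \<Longrightarrow> c \<odot>\<^bsub>Q_alg n\<^esub> coset_of n p = coset_of n (scal c p :: _ \<Rightarrow>\<^sub>0 'k)"
  using smult_coset[OF rel_ideal, of p n c]
  by (simp add: coset_of_def Q_alg_def supported_def scal_def map_mult_conv)

lemma coset_of_one: "\<one>\<^bsub>Q_alg n\<^esub> = coset_of n (1 :: _ \<Rightarrow>\<^sub>0 'k)"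
  by (simp add: coset_of_def Q_alg_def quotient_algebra_simps FactRing_def)

lemma coset_of_eq_iff:
  assumes "p \<in> free_carrier n" "q \<in> free_carrier n"
  shows "coset_of n p = coset_of n q \<longleftrightarrow> p - q \<in> I"
proof
  assume "coset_of n p = coset_of n q"
  moreover have "p \<in> coset_of n p"
    using a_rcos_self[of p] assms(1) by (simp add: coset_of_def supported_def I_def)
  ultimately have "p \<in> coset_of n q" by simp
  then show "p - q \<in> I"
    by (auto simp: coset_of_def a_r_coset_def' I_def)
next
  assume "p - q \<in> I"
  then have "p \<in> I +>\<^bsub>free_Q n\<^esub> q"
    unfolding a_r_coset_def' by (auto intro!: bexI[of _ "p - q"])
  from a_repr_independence[OF this _ a_subgroup] show "coset_of n p = coset_of n q"
    using assms by (simp add: coset_of_def supported_def I_def)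
qed

lemma coset_of_zero: "\<zero>\<^bsub>Q_alg n\<^esub> = coset_of n (0 :: _ \<Rightarrow>\<^sub>0 'k)"
proof -
  have "I +>\<^bsub>free_Q n\<^esub> \<zero>\<^bsub>free_Q n\<^esub> = I"
    by (rule a_coset_add_zero) (use a_Hcarr in auto)
  then show ?thesis
    by (simp add: coset_of_def Q_alg_def quotient_algebra_simps FactRing_def I_def)
qed

end

lemma free_gen_carrier: "A \<subseteq> {1..n} \<Longrightarrow> i \<in> {1..n} - A \<Longrightarrow> free_gen (A, i) \<in> free_carrier n"
  by (rule free_gen_supported) (simp add: gens_def)

lemma r_lift_ord_carrier:
  assumes "distinct cs" "set cs \<subseteq> {1..n}"
  shows "r_lift_ord cs \<in> free_carrier n"
  using assms
  by (induction cs rule: rev_induct)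
    (auto intro!: supported_add free_gen_carrier)

lemma r_lift_carrier: "A \<subseteq> {1..n} \<Longrightarrow> r_lift A \<in> free_carrier n"
  unfolding r_lift_def using finite_subset[of A "{1..n}"] by (intro r_lift_ord_carrier) auto

lemma r_prod_carrier: "\<forall>A\<in>set As. A \<subseteq> {1..n} \<Longrightarrow> r_prod As \<in> free_carrier n"
  by (induction As) (auto intro!: free_carrier_1 free_carrier_mult r_lift_carrier)

lemma coset_of_r_lift_ord:
  assumes "distinct cs" "set cs \<subseteq> {1..n}"
  shows "coset_of n (r_lift_ord cs) = (r_ord n cs :: (_ \<Rightarrow>\<^sub>0 'k::field) set)"
  using assms
proof (induction cs rule: rev_induct)
  case Nil
  interpret ring "Q_alg n :: ('k, _) module" by (rule ring_Q_alg)
  show ?case by (simp add: r_ord_def coset_of_zero)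
next
  case (snoc c cs)
  have "free_gen (set cs, c) \<in> (free_carrier n :: (_ \<Rightarrow>\<^sub>0 'k) set)" "r_lift_ord cs \<in> (free_carrier n :: (_ \<Rightarrow>\<^sub>0 'k) set)"
    using snoc.prems by (auto intro!: free_gen_carrier r_lift_ord_carrier)
  then show ?case
    using snoc by (simp add: r_ord_snoc z_elt_def flip: coset_of_add coset_of_def)
qed

lemma coset_of_r_lift: "A \<subseteq> {1..n} \<Longrightarrow> coset_of n (r_lift A) = (r_elt n A :: (_ \<Rightarrow>\<^sub>0 'k::field) set)"
  unfolding r_lift_def r_elt_def using finite_subset[of A "{1..n}"] by (intro coset_of_r_lift_ord) auto

lemma r_lift_insert:
  assumes "A \<subseteq> {1..n}" "i \<in> {1..n} - A"
  shows "r_lift (insert i A) - (free_gen (A, i) + r_lift A) \<in> (rel_ideal n :: (_ \<Rightarrow>\<^sub>0 'k::field) set)"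
proof -
  have fin: "finite A" using assms finite_subset by auto
  let ?cs = "sorted_list_of_set A"
  have c: "(free_gen (A, i) + r_lift A :: _ \<Rightarrow>\<^sub>0 'k) = r_lift_ord (?cs @ [i])"
    using fin by (simp add: r_lift_def)
  have "coset_of n (r_lift (insert i A)) = (r_elt n (set (?cs @ [i])) :: (_ \<Rightarrow>\<^sub>0 'k) set)"
    using assms fin by (subst coset_of_r_lift) auto
  also have "\<dots> = r_ord n (?cs @ [i])"
    using assms fin by (intro r_elt_eq_r_ord) auto
  also have "\<dots> = coset_of n (r_lift_ord (?cs @ [i]))"
    using assms fin by (intro coset_of_r_lift_ord[symmetric]) auto
  finally have "coset_of n (r_lift (insert i A)) = coset_of n (r_lift_ord (?cs @ [i]) :: _ \<Rightarrow>\<^sub>0 'k)" .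
  then show ?thesis
    unfolding c using assms fin
    by (subst (asm) coset_of_eq_iff) (auto intro!: supported_add free_gen_carrier r_lift_carrier r_lift_ord_carrier)
qed

lemma coset_of_r_prod:
  assumes "\<forall>A\<in>set As. A \<subseteq> {1..n}"
  shows "Q_prod n (map (r_elt n) As) = (coset_of n (r_prod As) :: (_ \<Rightarrow>\<^sub>0 'k::field) set)"
  using assms
proof (induction As)
  case Nil
  then show ?case by (simp add: Q_prod_def coset_of_one)
next
  case (Cons A As)
  then show ?case
    by (simp add: Q_prod_def coset_of_mult r_lift_carrier r_prod_carrier flip: coset_of_r_lift)
qed

lemma descent_subset: "B \<in> set (descent A j) \<Longrightarrow> B \<subseteq> A"
  using drop_largest_subset by (auto simp: descent_def)

lemma r_desc_eq_coset_of:
  assumes "A \<subseteq> {1..n}"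
  shows "r_desc n A j = (coset_of n (r_prod (descent A j)) :: (_ \<Rightarrow>\<^sub>0 'k::field) set)"
proof -
  have "r_desc n A j = (Q_prod n (map (r_elt n) (descent A j)) :: (_ \<Rightarrow>\<^sub>0 'k) set)"
    by (simp add: r_desc_def descent_def comp_def)
  also have "\<dots> = coset_of n (r_prod (descent A j))"
    using assms descent_subset by (intro coset_of_r_prod) blast
  finally show ?thesis .
qed

lemma flatten_subset:
  assumes "admissible n ps" "A \<in> set (flatten ps)"
  shows "A \<subseteq> {1..n}"
proof -
  obtain B j where Bj: "(B, j) \<in> set ps" "A \<in> set (descent B j)"
    using assms(2) by (auto simp: flatten_def)
  then have "B \<subseteq> {1..n}"
    using assms(1) unfolding admissible_def by blast
  then show ?thesis
    using descent_subset[OF Bj(2)] by blast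
qed

lemma basis_products_eq_coset_of:
  "basis_products n = {coset_of n (r_prod (flatten ps)) :: (_ \<Rightarrow>\<^sub>0 'k::field) set | ps. admissible n ps}"
proof -
  have "Q_prod n (map (\<lambda>(A, j). r_desc n A j) ps) = (coset_of n (r_prod (flatten ps)) :: (_ \<Rightarrow>\<^sub>0 'k) set)"
    if "\<forall>(A, j)\<in>set ps. A \<subseteq> {1..n}" for ps
    using that
  proof (induction ps)
    case Nil
    then show ?case by (simp add: Q_prod_def flatten_def coset_of_one)
  next
    case (Cons p ps)
    obtain A j where p: "p = (A, j)" by force
    have A: "A \<subseteq> {1..n}" using Cons.prems by (simp add: p)
    have c: "r_prod (descent A j) \<in> (free_carrier n :: (_ \<Rightarrow>\<^sub>0 'k) set)"
      "r_prod (flatten ps) \<in> (free_carrier n :: (_ \<Rightarrow>\<^sub>0 'k) set)"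
      using A Cons.prems descent_subset
      by (fastforce intro!: r_prod_carrier simp: flatten_def)+
    have "Q_prod n (map (\<lambda>(A, j). r_desc n A j) (p # ps))
        = r_desc n A j \<otimes>\<^bsub>Q_alg n\<^esub> (Q_prod n (map (\<lambda>(A, j). r_desc n A j) ps) :: (_ \<Rightarrow>\<^sub>0 'k) set)"
      by (simp add: Q_prod_def p)
    also have "\<dots> = coset_of n (r_prod (flatten (p # ps)))"
      using Cons c by (simp add: r_desc_eq_coset_of[OF A] coset_of_mult p flatten_def)
    finally show ?case .
  qed
  then have "Q_prod n (map (\<lambda>(A, j). r_desc n A j) ps) = (coset_of n (r_prod (flatten ps)) :: (_ \<Rightarrow>\<^sub>0 'k) set)"
    if "admissible n ps" for ps
    using that unfolding admissible_def by blast
  then show ?thesis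
    unfolding basis_products_def by (intro Collect_cong) metis
qed

section \<open>Spanning\<close>

definition total_size :: "nat set list \<Rightarrow> nat" where
  "total_size As = (\<Sum>A\<leftarrow>As. card A)"

lemma total_size_simps [simp]:
  "total_size [] = 0" "total_size (A # As) = card A + total_size As" "total_size (As @ Bs) = total_size As + total_size Bs"
  by (simp_all add: total_size_def)

text \<open>The products of elements \<open>r(A)\<close> of weight less than \<open>m\<close>. Since the ideal is included, two
  elements of the free algebra are congruent modulo products of smaller weight in \<open>Q\<^sub>n\<close> if and only if their
  difference lies in this span.\<close>
definition lower_span :: "nat \<Rightarrow> nat \<Rightarrow> ((nat set \<times> nat) list \<Rightarrow>\<^sub>0 'k::field) set" where
  "lower_span n m = words.span ({r_prod As | As. (\<forall>A\<in>set As. A \<subseteq> {1..n}) \<and> total_size As < m} \<union> rel_ideal n)"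

lemma span_mult_left:
  fixes p :: "'g list \<Rightarrow>\<^sub>0 'k::field"
  assumes "x \<in> words.span S" "\<And>s. s \<in> S \<Longrightarrow> p * s \<in> words.span T"
  shows "p * x \<in> words.span T"
proof -
  have "words.span S \<subseteq> {x. p * x \<in> words.span T}"
    using assms(2)
    by (intro words.span_minimal words.subspaceI)
      (auto simp: distrib_left mult_scal intro: words.span_zero words.span_add words.span_scale)
  then show ?thesis using assms(1) by auto
qed

lemma span_mult_right:
  fixes p :: "'g list \<Rightarrow>\<^sub>0 'k::field"
  assumes "x \<in> words.span S" "\<And>s. s \<in> S \<Longrightarrow> s * p \<in> words.span T"
  shows "x * p \<in> words.span T"
proof -
  have "words.span S \<subseteq> {x. x * p \<in> words.span T}"
    using assms(2)
    by (intro words.span_minimal words.subspaceI)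
      (auto simp: distrib_right scal_mult intro: words.span_zero words.span_add words.span_scale)
  then show ?thesis using assms(1) by auto
qed

lemma lower_span_rel_ideal: "p \<in> rel_ideal n \<Longrightarrow> p \<in> lower_span n m"
  unfolding lower_span_def by (intro words.span_base) auto

lemma lower_span_r_prod: "\<forall>A\<in>set As. A \<subseteq> {1..n} \<Longrightarrow> total_size As < m \<Longrightarrow> r_prod As \<in> lower_span n m"
  unfolding lower_span_def by (intro words.span_base) auto

lemma lower_span_add: "p \<in> lower_span n m \<Longrightarrow> q \<in> lower_span n m \<Longrightarrow> p + q \<in> lower_span n m"
  and lower_span_diff: "p \<in> lower_span n m \<Longrightarrow> q \<in> lower_span n m \<Longrightarrow> p - q \<in> lower_span n m"
  unfolding lower_span_def by (auto intro: words.span_add words.span_diff)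

lemma lower_span_mult_left:
  assumes "\<forall>A\<in>set As. A \<subseteq> {1..n}" "x \<in> lower_span n m"
  shows "r_prod As * x \<in> lower_span n (total_size As + m)"
  using assms(2) unfolding lower_span_def
proof (rule span_mult_left)
  fix s :: "(nat set \<times> nat) list \<Rightarrow>\<^sub>0 'a"
  assume "s \<in> {r_prod Bs | Bs. (\<forall>A\<in>set Bs. A \<subseteq> {1..n}) \<and> total_size Bs < m} \<union> rel_ideal n"
  then have "r_prod As * s \<in> lower_span n (total_size As + m)"
  proof
    assume "s \<in> {r_prod Bs | Bs. (\<forall>A\<in>set Bs. A \<subseteq> {1..n}) \<and> total_size Bs < m}"
    then obtain Bs where "s = r_prod Bs" "\<forall>A\<in>set Bs. A \<subseteq> {1..n}" "total_size Bs < m"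
      by auto
    then show ?thesis
      using lower_span_r_prod[of "As @ Bs" n "total_size As + m"] assms(1) by auto
  next
    assume "s \<in> rel_ideal n"
    then show ?thesis
      by (intro lower_span_rel_ideal rel_ideal_mult_left r_prod_carrier assms(1))
  qed
  then show "r_prod As * s \<in> words.span ({r_prod Bs | Bs. (\<forall>A\<in>set Bs. A \<subseteq> {1..n}) \<and> total_size Bs < total_size As + m} \<union> rel_ideal n)"
    unfolding lower_span_def .
qed

lemma lower_span_mult_right:
  assumes "\<forall>A\<in>set As. A \<subseteq> {1..n}" "x \<in> lower_span n m"
  shows "x * r_prod As \<in> lower_span n (m + total_size As)"
  using assms(2) unfolding lower_span_def
proof (rule span_mult_right)
  fix s :: "(nat set \<times> nat) list \<Rightarrow>\<^sub>0 'a"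
  assume "s \<in> {r_prod Bs | Bs. (\<forall>A\<in>set Bs. A \<subseteq> {1..n}) \<and> total_size Bs < m} \<union> rel_ideal n"
  then have "s * r_prod As \<in> lower_span n (m + total_size As)"
  proof
    assume "s \<in> {r_prod Bs | Bs. (\<forall>A\<in>set Bs. A \<subseteq> {1..n}) \<and> total_size Bs < m}"
    then obtain Bs where "s = r_prod Bs" "\<forall>A\<in>set Bs. A \<subseteq> {1..n}" "total_size Bs < m"
      by auto
    then show ?thesis
      using lower_span_r_prod[of "Bs @ As" n "m + total_size As"] assms(1) by auto
  next
    assume "s \<in> rel_ideal n"
    then show ?thesis
      by (intro lower_span_rel_ideal rel_ideal_mult_right r_prod_carrier assms(1))
  qed
  then show "s * r_prod As \<in> words.span ({r_prod Bs | Bs. (\<forall>A\<in>set Bs. A \<subseteq> {1..n}) \<and> total_size Bs < m + total_size As} \<union> rel_ideal n)"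
    unfolding lower_span_def .
qed

text \<open>With \<open>A = B - {i, j}\<close> the quadratic relation reads
  \<open>(r(B) - r(A \<union> {i})) (r(A \<union> {i}) - r(A)) = (r(B) - r(A \<union> {j})) (r(A \<union> {j}) - r(A))\<close>. The terms
  \<open>r(B) r(A)\<close> cancel, and what remains besides \<open>r(B) r(A \<union> {i})\<close> and \<open>r(B) r(A \<union> {j})\<close> has weight at most
  \<open>2|B| - 2\<close>.\<close>
lemma exchange_relation:
  assumes B: "B \<subseteq> {1..n}" and ij: "i \<in> B" "j \<in> B" "i \<noteq> j"
  shows "r_lift B * r_lift (B - {i}) - r_lift B * r_lift (B - {j}) \<in> (lower_span n (card B + (card B - 1)) :: (_ \<Rightarrow>\<^sub>0 'k::field) set)"
proof -
  define A where "A = B - {i, j}"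
  have A: "A \<subseteq> {1..n}" "i \<in> {1..n} - A" "j \<in> {1..n} - A"
    and sets: "B - {j} = insert i A" "B - {i} = insert j A" "B = insert j (insert i A)" "B = insert i (insert j A)"
    using B ij by (auto simp: A_def)
  have fin: "finite A" using A finite_subset by auto
  have card: "card B = Suc (Suc (card A))"
    unfolding sets(3) using ij fin by (simp add: A_def)
  let ?I = "rel_ideal n :: (_ \<Rightarrow>\<^sub>0 'k) set"
  let ?z = "\<lambda>A i. free_gen (A, i) :: _ \<Rightarrow>\<^sub>0 'k"
  let ?r = "r_lift :: _ \<Rightarrow> (_ \<Rightarrow>\<^sub>0 'k)"
  have diff: "p - q \<in> ?I" if "p \<in> ?I" "q \<in> ?I" for p q
    by (rule words.subspace_diff[OF rel_ideal_subspace that])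
  have step: "(?r (insert j (insert i A)) - ?r (insert i A)) * (?r (insert i A) - ?r A)
      - ?z (insert i A) j * ?z A i \<in> ?I"
    if "i \<in> {1..n} - A" "j \<in> {1..n} - A" "i \<noteq> j" for i j
  proof -
    define d e where "d = ?r (insert j (insert i A)) - (?z (insert i A) j + ?r (insert i A))"
      and "e = ?r (insert i A) - (?z A i + ?r A)"
    have de: "d \<in> ?I" "e \<in> ?I"
      unfolding d_def e_def using A that by (auto intro!: r_lift_insert)
    have "?z A i \<in> free_carrier n" "?z (insert i A) j \<in> free_carrier n"
      using A that by (auto intro!: free_gen_carrier)
    then have "d * (e + ?z A i) + ?z (insert i A) j * e \<in> ?I"
      using de by (intro rel_ideal_add rel_ideal_mult_left rel_ideal_mult_right supported_add)
        (auto intro: rel_ideal_carrier)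
    then show ?thesis
      by (simp add: d_def e_def algebra_simps)
  qed
  have "?z (insert i A) j * ?z A i - ?z (insert j A) i * ?z A j \<in> relators n"
    unfolding relators_def using A ij by blast
  then have rel: "?z (insert i A) j * ?z A i - ?z (insert j A) i * ?z A j \<in> ?I"
    unfolding rel_ideal_def
    using ring.genideal_self[OF ring_free_algebra relators_closed] by blast
  define d where "d = ((?r B - ?r (insert j A)) * (?r (insert j A) - ?r A)
      - ?z (insert j A) i * ?z A j)
      - ((?r B - ?r (insert i A)) * (?r (insert i A) - ?r A)
      - ?z (insert i A) j * ?z A i)
      - (?z (insert i A) j * ?z A i - ?z (insert j A) i * ?z A j)"
  have d: "d \<in> ?I"
    unfolding d_def
    by (rule diff[OF diff[OF step[of j i, folded sets(4)] step[of i j, folded sets(3)]] rel])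
      (use A ij in auto)
  have "?r B * ?r (B - {i}) - ?r B * ?r (B - {j})
      = d + (r_prod [insert j A, insert j A] - r_prod [insert j A, A])
        - (r_prod [insert i A, insert i A] - r_prod [insert i A, A])"
    unfolding sets(1,2) by (simp add: d_def algebra_simps)
  also have "\<dots> \<in> lower_span n (card B + (card B - 1))"
    using A ij fin by (intro lower_span_diff lower_span_add lower_span_r_prod lower_span_rel_ideal[OF d]) (auto simp: card)
  finally show ?thesis .
qed

fun chain :: "nat set list \<Rightarrow> bool" where
  "chain (A # B # L) \<longleftrightarrow> B \<subseteq> A \<and> card A = Suc (card B) \<and> chain (B # L)"
| "chain L \<longleftrightarrow> True"

lemma total_size_chain: "chain (A # L) \<Longrightarrow> total_size (A # L) = descent_weight (card A) (Suc (length L))"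
proof (induction L arbitrary: A)
  case (Cons B L)
  then show ?case
    using descent_weight_add[of "card A" 1 "Suc (length L)"] by simp
qed simp

lemma chain_length: "chain (A # L) \<Longrightarrow> length L \<le> card A"
  by (induction L arbitrary: A) auto

lemma chain_snocD: "chain (L @ [C]) \<Longrightarrow> chain L"
  by (induction L rule: chain.induct) auto

lemma descent_Suc: "finite A \<Longrightarrow> descent A (Suc k) = A # descent (drop_largest 1 A) k"
  by (simp add: descent_def upt_conv_Cons map_Suc_upt[symmetric] drop_largest_drop_largest comp_def del: upt_Suc)

lemma descent_Suc_snoc: "descent A (Suc k) = descent A k @ [drop_largest k A]"
  by (simp add: descent_def)

text \<open>The bound \<open>|A| + 1\<close> allows the descent to reach the empty set.\<close>
lemma chain_descent:
  assumes "finite A" "k \<le> Suc (card A)"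
  shows "chain (descent A k)"
  using assms
proof (induction k arbitrary: A)
  case (Suc k)
  have "chain (A # descent (drop_largest 1 A) k)"
  proof (cases k)
    case (Suc k')
    then have "card A > 0" using Suc.prems by auto
    then have "chain (descent (drop_largest 1 A) k)"
      using Suc.prems by (intro Suc.IH) (auto simp: finite_drop_largest card_drop_largest)
    then show ?thesis
      using Suc Suc.prems \<open>card A > 0\<close>
      by (simp add: descent_Suc finite_drop_largest drop_largest_subset card_drop_largest)
  qed (simp add: descent_def)
  then show ?case by (simp add: descent_Suc Suc.prems)
qed (simp add: descent_def)

lemma length_descent [simp]: "length (descent A k) = k"
  by (simp add: descent_def)

lemma total_size_descent: "finite A \<Longrightarrow> total_size (descent A k) = descent_weight (card A) k"
  by (induction k) (simp_all add: descent_Suc_snoc descent_weight_def card_drop_largest, simp_all add: descent_def)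

text \<open>Any descending chain can be deformed into the one that removes the largest elements first.
  By induction, the part below \<open>A\<close> may be taken to remove largest elements. If the second set is
  \<open>B = A - {i}\<close> with \<open>i \<noteq> Max A\<close>, then the third one is now \<open>E = A - {i, Max A}\<close>, the exchange relation
  replaces \<open>B\<close> by \<open>D = A - {Max A}\<close>, which also contains \<open>E\<close>, and the induction hypothesis
  applies to the chain from \<open>D\<close>.\<close>
lemma chain_equiv_descent:
  assumes "A \<subseteq> {1..n}" "chain (A # L)"
  shows "r_prod (A # L) - r_prod (descent A (Suc (length L)))
    \<in> (lower_span n (total_size (A # L)) :: (_ \<Rightarrow>\<^sub>0 'k::field) set)"
  using assms
proof (induction "length L" arbitrary: A L rule: less_induct)
  case less
  let ?r = "r_lift :: _ \<Rightarrow> (_ \<Rightarrow>\<^sub>0 'k)" and ?p = "r_prod :: _ \<Rightarrow> (_ \<Rightarrow>\<^sub>0 'k)"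
  have fin: "finite A" using less.prems(1) finite_subset by auto
  show ?case
  proof (cases L)
    case Nil
    then show ?thesis
      by (simp add: descent_def lower_span_rel_ideal rel_ideal_0)
  next
    case L: (Cons B L')
    let ?k = "length L'"
    have B: "B \<subseteq> A" "card A = Suc (card B)" "chain (B # L')" "B \<subseteq> {1..n}" "finite B"
      using less.prems fin L finite_subset by auto
    have tot: "total_size (A # L) = card A + total_size (B # L')"
      by (simp add: L)
    define D where "D = drop_largest 1 A"
    have "A \<noteq> {}" using B(2) by auto
    then have D4: "Max A \<in> A" using Max_in[OF fin] by blast
    have D: "D \<subseteq> {1..n}" "finite D" "D = A - {Max A}" "Max A \<in> A"
      using D4 less.prems(1) drop_largest_subset fin B(2) drop_largest_1[OF fin]
      by (auto simp: D_def finite_drop_largest)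
    have left: "?r A * x \<in> lower_span n (total_size (A # L))" if "x \<in> lower_span n (total_size (B # L'))" for x
      using lower_span_mult_left[of "[A]", OF _ that] less.prems(1) unfolding tot by simp
    have "?p (B # L') - ?p (descent B (Suc ?k)) \<in> lower_span n (total_size (B # L'))"
      using B by (intro less.hyps) (auto simp: L)
    from left[OF this]
    have 1: "?p (A # L) - ?r A * ?p (descent B (Suc ?k)) \<in> lower_span n (total_size (A # L))"
      by (simp add: L algebra_simps)
    have descA: "?p (descent A (Suc (length L))) = ?r A * ?p (descent D (Suc ?k))"
      using fin by (simp add: L descent_Suc D_def)
    show ?thesis
    proof (cases "B = D")
      case True
      then show ?thesis using 1 descA by simp
    next
      case False
      have "card (A - B) = 1"
        using B by (simp add: card_Diff_subset)
      then obtain i where i: "A - B = {i}" by (auto simp: card_1_singleton_iff)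
      then have iA: "i \<in> A" "B = A - {i}" using B(1) by auto
      then have im: "i \<noteq> Max A" using False D(3) by auto
      then have mB: "Max A \<in> B" using D(4) iA by auto
      have "Max B = Max A"
        using mB B(1,5) fin by (intro Max_eqI) auto
      then have EB: "drop_largest 1 B = B - {Max A}"
        using drop_largest_1[OF B(5)] mB by auto
      define E where "E = B - {Max A}"
      have E: "E \<subseteq> D" "finite E" "card D = Suc (card E)" "card B = Suc (card E)" "E \<subseteq> {1..n}"
      proof -
        show "E \<subseteq> D" "E \<subseteq> {1..n}" using B(1,4) D(3) by (auto simp: E_def)
        show "finite E" using B(5) by (simp add: E_def)
        show "card B = Suc (card E)" using mB B(5) by (simp add: E_def card_Suc_Diff1 del: card_Diff_insert)
        then show "card D = Suc (card E)"
          using D(3,4) B(2) fin by simp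
      qed
      have descB: "descent B (Suc ?k) = B # descent E ?k"
        unfolding descent_Suc[OF B(5)] EB E_def ..
      have k: "?k \<le> Suc (card E)" using chain_length[OF B(3)] E(4) by simp
      have chE: "chain (D # descent E ?k)"
      proof (cases ?k)
        case (Suc k')
        then show ?thesis
          using chain_descent[OF E(2) k] E by (simp add: descent_Suc)
      qed (simp add: descent_def)
      have tE: "total_size (descent E ?k) = descent_weight (card E) ?k"
        by (rule total_size_descent[OF E(2)])
      have tB: "total_size (B # L') = card B + descent_weight (card E) ?k"
        unfolding total_size_chain[OF B(3)] using descent_weight_add[of "card B" 1 ?k] E(4) by simp
      have totA: "total_size (A # L) = card A + (card A - 1) + descent_weight (card E) ?k"
        unfolding tot tB using B(2) by simp
      have sub: "\<forall>A\<in>set (descent E ?k). A \<subseteq> {1..n}"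
        using descent_subset E(5) by blast
      have "(?r A * ?r B - ?r A * ?r D) * ?p (descent E ?k)
          \<in> lower_span n (card A + (card A - 1) + total_size (descent E ?k))"
        using exchange_relation[OF less.prems(1) iA(1) D(4) im, where 'k = 'k]
        by (intro lower_span_mult_right sub) (simp add: iA(2) D(3))
      then have 2: "?r A * ?p (descent B (Suc ?k)) - ?r A * ?p (D # descent E ?k) \<in> lower_span n (total_size (A # L))"
        unfolding totA by (simp add: descB tE algebra_simps)
      have "?p (D # descent E ?k) - ?p (descent D (Suc (length (descent E ?k)))) \<in> lower_span n (total_size (D # descent E ?k))"
        by (rule less.hyps[OF _ D(1) chE]) (simp add: L)
      moreover have "total_size (D # descent E ?k) = total_size (B # L')"
        using E tE tB by simp
      ultimately have "?p (D # descent E ?k) - ?p (descent D (Suc ?k)) \<in> lower_span n (total_size (B # L'))"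
        by simp
      from left[OF this]
      have 3: "?r A * ?p (D # descent E ?k) - ?r A * ?p (descent D (Suc ?k)) \<in> lower_span n (total_size (A # L))"
        by (simp add: algebra_simps)
      from lower_span_add[OF lower_span_add[OF 1 2] 3] show ?thesis
        unfolding descA by simp
    qed
  qed
qed

lemma ex_chain:
  assumes "finite A" "C \<subseteq> A" "card A = card C + Suc j"
  shows "\<exists>L. length L = j \<and> chain (A # L @ [C])"
  using assms
proof (induction j arbitrary: A)
  case 0
  then show ?case by (intro exI[of _ "[]"]) auto
next
  case (Suc j)
  then have "C \<noteq> A" by auto
  then obtain x where x: "x \<in> A" "x \<notin> C" using Suc.prems(2) by auto
  then obtain L where L: "length L = j" "chain ((A - {x}) # L @ [C])"
    using Suc.IH[of "A - {x}"] Suc.prems by auto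
  then show ?case
    using x Suc.prems by (intro exI[of _ "(A - {x}) # L"]) (auto simp: card_Suc_Diff1)
qed

text \<open>There is a chain of length \<open>j\<close> that starts with \<open>A\<close> and can be continued by \<open>C\<close>. Up to smaller
  weight, \<open>r(A:j)\<close> is the product along it and \<open>r(A:j+1)\<close> the product along its continuation.\<close>
lemma descent_mult_blocked:
  assumes A: "A \<subseteq> {1..n}" "1 \<le> j" "j \<le> card A" and C: "C \<subseteq> A" "card C = card A - j"
  shows "r_prod (descent A j) * r_lift C - r_prod (descent A (Suc j))
    \<in> (lower_span n (descent_weight (card A) j + card C) :: (_ \<Rightarrow>\<^sub>0 'k::field) set)"
proof -
  have fin: "finite A" using A finite_subset by auto
  have "card A = card C + Suc (j - 1)" using A C by auto
  from ex_chain[OF fin C(1) this] obtain L where L: "length L = j - 1" "chain (A # L @ [C])"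
    by auto
  have ch: "chain (A # L)" using chain_snocD[of "A # L" C] L(2) by simp
  have j: "Suc (length L) = j" using L A by auto
  let ?p = "r_prod :: _ \<Rightarrow> (_ \<Rightarrow>\<^sub>0 'k)"
  have t: "total_size (A # L) = descent_weight (card A) j"
    using total_size_chain[OF ch] by (simp add: j)
  have "?p (A # L) - ?p (descent A j) \<in> lower_span n (descent_weight (card A) j)"
    using chain_equiv_descent[OF A(1) ch, where 'k = 'k] unfolding j t .
  from lower_span_mult_right[of "[C]", OF _ this]
  have "(?p (A # L) - ?p (descent A j)) * r_lift C \<in> lower_span n (descent_weight (card A) j + card C)"
    using A C by auto
  moreover have "?p (A # L @ [C]) - ?p (descent A (Suc j)) \<in> lower_span n (descent_weight (card A) j + card C)"
  proof -
    have "total_size (A # L @ [C]) = descent_weight (card A) j + card C"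
      using t by simp
    then show ?thesis
      using chain_equiv_descent[OF A(1) L(2), where 'k = 'k] j by (simp del: r_prod_simps total_size_simps)
  qed
  ultimately have "(?p (A # L @ [C]) - ?p (descent A (Suc j))) - (?p (A # L) - ?p (descent A j)) * r_lift C
      \<in> lower_span n (descent_weight (card A) j + card C)"
    by (rule lower_span_diff[rotated])
  then show ?thesis by (simp add: algebra_simps)
qed

definition admissible_span :: "nat \<Rightarrow> nat \<Rightarrow> ((nat set \<times> nat) list \<Rightarrow>\<^sub>0 'k::field) set" where
  "admissible_span n m = words.span ({r_prod (flatten ps) | ps. admissible n ps \<and> total_size (flatten ps) < m} \<union> rel_ideal n)"

lemma flatten_snoc [simp]: "flatten (ps @ [(A, j)]) = flatten ps @ descent A j"
  by (simp add: flatten_def)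

lemma r_lift_empty [simp]: "r_lift {} = 0"
  by (simp add: r_lift_def)

lemma admissible_mult:
  assumes ps: "admissible n ps" and C: "C \<subseteq> {1..n}"
    and lower: "(lower_span n (total_size (flatten ps) + card C) :: (_ \<Rightarrow>\<^sub>0 'k::field) set) \<subseteq> admissible_span n m"
    and m: "total_size (flatten ps) + card C < m"
  shows "r_prod (flatten ps) * r_lift C \<in> (admissible_span n m :: (_ \<Rightarrow>\<^sub>0 'k) set)"
proof -
  let ?p = "r_prod :: _ \<Rightarrow> (_ \<Rightarrow>\<^sub>0 'k)"
  have base: "?p (flatten qs) \<in> admissible_span n m" if "admissible n qs" "total_size (flatten qs) < m" for qs
    using that unfolding admissible_span_def by (intro words.span_base) auto
  have finC: "finite C" using C finite_subset by auto
  consider "C = {}" | "C \<noteq> {}" "\<not> blocked (rev ps) C" | "C \<noteq> {}" "blocked (rev ps) C"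
    by blast
  then show ?thesis
  proof cases
    case 1
    then show ?thesis by (simp add: admissible_span_def words.span_zero)
  next
    case 2
    have "card C > 0" using 2 finC by (simp add: card_gt_0_iff)
    then have "admissible n (ps @ [(C, 1)])"
      using ps C 2 by (simp only: admissible_snoc) auto
    from base[OF this] show ?thesis
      using m by (simp add: descent_def)
  next
    case 3
    then obtain qs A j where ps_eq: "ps = qs @ [(A, j)]"
      by (cases ps rule: rev_cases) auto
    have A: "A \<subseteq> {1..n}" "1 \<le> j" "j \<le> card A" "\<not> blocked (rev qs) A" "admissible n qs"
      using ps by (auto simp: ps_eq admissible_snoc)
    have CA: "C \<subseteq> A" "card C = card A - j"
      using 3 by (auto simp: ps_eq)
    have finA: "finite A" using A(1) finite_subset by auto
    have cC: "card C > 0" using 3 finC by (simp add: card_gt_0_iff)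
    have "admissible n (qs @ [(A, Suc j)])"
      using A CA cC by (simp only: admissible_snoc) auto
    moreover have "total_size (flatten (qs @ [(A, Suc j)])) = total_size (flatten ps) + card C"
      using CA finA by (simp add: ps_eq descent_Suc_snoc card_drop_largest)
    ultimately have lead: "?p (flatten (qs @ [(A, Suc j)])) \<in> admissible_span n m"
      using m by (intro base) auto
    have "?p (flatten qs) * (?p (descent A j) * r_lift C - ?p (descent A (Suc j)))
        \<in> lower_span n (total_size (flatten qs) + (descent_weight (card A) j + card C))"
      using flatten_subset[OF A(5)] by (intro lower_span_mult_left descent_mult_blocked A CA) auto
    moreover have "total_size (flatten qs) + (descent_weight (card A) j + card C) = total_size (flatten ps) + card C"
      using finA by (simp add: ps_eq total_size_descent)
    ultimately have "?p (flatten qs) * (?p (descent A j) * r_lift C - ?p (descent A (Suc j))) \<in> admissible_span n m"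
      using lower by auto
    from words.span_add[OF this[unfolded admissible_span_def] lead[unfolded admissible_span_def]]
    show ?thesis
      by (simp add: ps_eq admissible_span_def algebra_simps)
  qed
qed

text \<open>Induction on \<open>m\<close>: a product with last factor \<open>r(C)\<close>, \<open>C\<close> nonempty, is a product of smaller
  weight times \<open>r(C)\<close>. By induction the former is a combination of admissible products, and these are
  multiplied by \<open>r(C)\<close> with an error of smaller weight.\<close>
lemma lower_span_subset_admissible_span: "lower_span n m \<subseteq> (admissible_span n m :: (_ \<Rightarrow>\<^sub>0 'k::field) set)"
proof (induction m rule: less_induct)
  case (less m)
  have mono: "admissible_span n m' \<subseteq> (admissible_span n m'' :: (_ \<Rightarrow>\<^sub>0 'k) set)" if "m' \<le> m''" for m' m''
    unfolding admissible_span_def using that by (intro words.span_mono) force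
  have word: "r_prod As \<in> (admissible_span n m :: (_ \<Rightarrow>\<^sub>0 'k) set)"
    if "\<forall>A\<in>set As. A \<subseteq> {1..n}" "total_size As < m" for As
  proof (cases As rule: rev_cases)
    case Nil
    have "admissible n []" by (simp add: admissible_def)
    then have "r_prod (flatten []) \<in> (admissible_span n m :: (_ \<Rightarrow>\<^sub>0 'k) set)"
      unfolding admissible_span_def using that(2)
      by (intro words.span_base UnI1 CollectI exI[of _ "[]"]) (auto simp: flatten_def Nil)
    then show ?thesis by (simp add: Nil flatten_def)
  next
    case (snoc Bs C)
    have C: "C \<subseteq> {1..n}" and Bs: "\<forall>A\<in>set Bs. A \<subseteq> {1..n}"
      using that by (auto simp: snoc)
    show ?thesis
    proof (cases "C = {}")
      case True
      then show ?thesis by (simp add: snoc admissible_span_def words.span_zero)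
    next
      case False
      then have cC: "card C > 0" using C finite_subset[OF C] by (simp add: card_gt_0_iff)
      have "r_prod Bs \<in> (lower_span n (Suc (total_size Bs)) :: (_ \<Rightarrow>\<^sub>0 'k) set)"
        using Bs by (intro lower_span_r_prod) auto
      then have "r_prod Bs \<in> (admissible_span n (Suc (total_size Bs)) :: (_ \<Rightarrow>\<^sub>0 'k) set)"
        using less.IH[of "Suc (total_size Bs)"] that(2) cC by (auto simp: snoc)
      then have "r_prod Bs * r_lift C \<in> (admissible_span n m :: (_ \<Rightarrow>\<^sub>0 'k) set)"
        unfolding admissible_span_def
      proof (rule span_mult_right)
        fix s :: "_ \<Rightarrow>\<^sub>0 'k"
        assume "s \<in> {r_prod (flatten ps) |ps. admissible n ps \<and> total_size (flatten ps) < Suc (total_size Bs)} \<union> rel_ideal n"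
        then have "s * r_lift C \<in> admissible_span n m"
        proof
          assume "s \<in> {r_prod (flatten ps) |ps. admissible n ps \<and> total_size (flatten ps) < Suc (total_size Bs)}"
          then obtain ps where ps: "s = r_prod (flatten ps)" "admissible n ps" "total_size (flatten ps) < Suc (total_size Bs)"
            by auto
          have m: "total_size (flatten ps) + card C < m"
            using ps(3) that(2) by (simp add: snoc)
          show ?thesis
            unfolding ps(1) using less.IH[OF m] mono[of "total_size (flatten ps) + card C" m] m
            by (intro admissible_mult ps(2) C) auto
        next
          assume "s \<in> rel_ideal n"
          then have "s * r_lift C \<in> rel_ideal n"
            by (intro rel_ideal_mult_right r_lift_carrier C)
          then show ?thesis
            unfolding admissible_span_def by (intro words.span_base) auto
        qed
        then show "s * r_lift C \<in> words.span ({r_prod (flatten ps) |ps. admissible n ps \<and> total_size (flatten ps) < m} \<union> rel_ideal n)"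
          unfolding admissible_span_def .
      qed
      then show ?thesis by (simp add: snoc)
    qed
  qed
  show ?case
    unfolding lower_span_def
  proof (rule words.span_minimal)
    show "{r_prod As | As. (\<forall>A\<in>set As. A \<subseteq> {1..n}) \<and> total_size As < m} \<union> rel_ideal n \<subseteq> (admissible_span n m :: (_ \<Rightarrow>\<^sub>0 'k) set)"
      using word by (auto simp: admissible_span_def intro: words.span_base)
  qed (simp add: admissible_span_def)
qed

lemma free_carrier_spanned:
  "free_carrier n \<subseteq> words.span ({r_prod (flatten ps) | ps. admissible n ps} \<union> (rel_ideal n :: (_ \<Rightarrow>\<^sub>0 'k::field) set))"
    (is "_ \<subseteq> words.span ?Adm")
proof -
  let ?R = "{r_prod As | As. \<forall>A\<in>set As. A \<subseteq> {1..n}} \<union> (rel_ideal n :: (_ \<Rightarrow>\<^sub>0 'k) set)"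
  have word: "Poly_Mapping.single w (1 :: 'k) \<in> words.span ?R" if "w \<in> lists (gens n)" for w
    using that
  proof (induction w rule: rev_induct)
    case Nil
    have "r_prod [] = Poly_Mapping.single [] (1 :: 'k)"
      using single_one[where 'a = "(nat set \<times> nat) list" and 'b = 'k] by (simp add: zero_list_def)
    then show ?case
      by (intro words.span_base UnI1) (auto intro!: exI[of _ "[]"])
  next
    case (snoc g w)
    obtain A i where g: "g = (A, i)" by force
    have A: "A \<subseteq> {1..n}" "i \<in> {1..n} - A" and w: "w \<in> lists (gens n)"
      using snoc.prems by (auto simp: g gens_def)
    have right: "Poly_Mapping.single w 1 * r_lift B \<in> words.span ?R" if "B \<subseteq> {1..n}" for B
      using snoc.IH[OF w]
    proof (rule span_mult_right)
      fix s assume "s \<in> ?R"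
      then show "s * r_lift B \<in> words.span ?R"
      proof
        assume "s \<in> {r_prod As | As. \<forall>A\<in>set As. A \<subseteq> {1..n}}"
        then obtain As where "s = r_prod As" "\<forall>A\<in>set As. A \<subseteq> {1..n}" by auto
        then show ?thesis
          using that by (intro words.span_base UnI1 CollectI exI[of _ "As @ [B]"]) auto
      qed (use that in \<open>auto intro!: words.span_base rel_ideal_mult_right r_lift_carrier\<close>)
    qed
    define d where "d = r_lift (insert i A) - (free_gen (A, i) + r_lift A :: _ \<Rightarrow>\<^sub>0 'k)"
    have "d \<in> rel_ideal n" unfolding d_def by (rule r_lift_insert[OF A])
    then have "Poly_Mapping.single w 1 * d \<in> words.span ?R"
      using w by (intro words.span_base UnI2 rel_ideal_mult_left) auto
    moreover have "Poly_Mapping.single w 1 * r_lift (insert i A) \<in> words.span ?R"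
        "Poly_Mapping.single w 1 * r_lift A \<in> words.span ?R"
      using A right[of "insert i A"] right[of A] by auto
    ultimately have "Poly_Mapping.single w 1 * r_lift (insert i A) - Poly_Mapping.single w 1 * r_lift A
        - Poly_Mapping.single w 1 * d \<in> words.span ?R"
      by (intro words.span_diff)
    also have "Poly_Mapping.single w 1 * r_lift (insert i A) - Poly_Mapping.single w 1 * r_lift A
        - Poly_Mapping.single w 1 * d = Poly_Mapping.single w 1 * free_gen (A, i)"
      by (simp add: d_def algebra_simps)
    also have "\<dots> = Poly_Mapping.single (w @ [g]) 1"
      by (simp add: free_gen_def g)
    finally show ?case .
  qed
  have "x \<in> words.span ?R" if "x \<in> free_carrier n" for x
    by (subst word_expansion, intro words.span_sum words.span_scale word)
      (use that in \<open>auto simp: supported_def\<close>)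
  moreover have "words.span ?R \<subseteq> words.span ?Adm"
  proof (rule words.span_minimal)
    show "?R \<subseteq> words.span ?Adm"
    proof
      fix s assume "s \<in> ?R"
      then show "s \<in> words.span ?Adm"
      proof
        assume "s \<in> {r_prod As | As. \<forall>A\<in>set As. A \<subseteq> {1..n}}"
        then obtain As where As: "s = r_prod As" "\<forall>A\<in>set As. A \<subseteq> {1..n}" by blast
        have "s \<in> lower_span n (Suc (total_size As))"
          unfolding As(1) by (rule lower_span_r_prod[OF As(2)]) simp
        then have "s \<in> admissible_span n (Suc (total_size As))"
          by (rule subsetD[OF lower_span_subset_admissible_span])
        moreover have "admissible_span n (Suc (total_size As)) \<subseteq> words.span ?Adm"
          unfolding admissible_span_def by (intro words.span_mono) auto
        ultimately show ?thesis by auto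
      qed (auto intro: words.span_base)
    qed
  qed simp
  ultimately show ?thesis by auto
qed

section \<open>The basis theorem\<close>

lemma alg_act_admissible:
  assumes "admissible n ps"
  shows "has_leading_word n (rev ps) (alg_act (r_prod (flatten ps)) (Poly_Mapping.single [] (1 :: 'k::field)))"
proof -
  have "\<forall>A\<in>set (flatten ps). finite A"
    using flatten_subset[OF assms] finite_subset by blast
  then show ?thesis
    using has_leading_word_flatten[OF assms, where 'k = 'k] by (simp add: alg_act_r_prod)
qed

text \<open>In a relation with nonzero coefficients, take \<open>qs\<close> of largest weight among the \<open>ps\<close> with
  \<open>a ps \<noteq> 0\<close> and compare the coefficients of its leading word after letting both sides act on
  the empty word.\<close>
lemma admissible_independent:
  fixes a :: "letter list \<Rightarrow> 'k::field"
  assumes fin: "finite P" and adm: "\<forall>ps\<in>P. admissible n ps"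
    and rel: "(\<Sum>ps\<in>P. scal (a ps) (r_prod (flatten ps))) \<in> rel_ideal n"
  shows "\<forall>ps\<in>P. a ps = 0"
proof (rule ccontr)
  assume "\<not> (\<forall>ps\<in>P. a ps = 0)"
  then have ne: "{ps \<in> P. a ps \<noteq> 0} \<noteq> {}" by auto
  let ?e = "Poly_Mapping.single [] (1 :: 'k) :: letter list \<Rightarrow>\<^sub>0 'k"
  define X where "X ps = alg_act (r_prod (flatten ps)) ?e" for ps
  define wt where "wt ps = word_weight (rev ps)" for ps
  define M where "M = Max (wt ` {ps \<in> P. a ps \<noteq> 0})"
  have "M \<in> wt ` {ps \<in> P. a ps \<noteq> 0}"
    unfolding M_def using ne fin by (intro Max_in) auto
  then obtain qs where qs: "qs \<in> P" "a qs \<noteq> 0" "wt qs = M" by auto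
  have le: "wt ps \<le> wt qs" if "ps \<in> P" "a ps \<noteq> 0" for ps
    unfolding qs(3) M_def using that fin by (intro Max_ge) auto
  have "?e \<in> normal_span n" by (simp add: normal_span_def)
  from rel_ideal_act[OF rel this]
  have "alg_act (\<Sum>ps\<in>P. scal (a ps) (r_prod (flatten ps))) ?e = 0" .
  moreover have "alg_act (\<Sum>ps\<in>P. scal (a ps) (r_prod (flatten ps))) ?e = (\<Sum>ps\<in>P. scal (a ps) (X ps))"
    using fin by (induction P) (simp_all add: alg_act_add_left alg_act_scal_left X_def)
  ultimately have "(\<Sum>ps\<in>P. a ps * Poly_Mapping.lookup (X ps) (rev qs)) = 0"
    using lookup_sum[of "\<lambda>ps. scal (a ps) (X ps)" P "rev qs"] by simp
  moreover have "a ps * Poly_Mapping.lookup (X ps) (rev qs) = (if ps = qs then a qs else 0)"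
    if ps: "ps \<in> P" for ps
  proof (cases "a ps = 0")
    case False
    have "X ps - Poly_Mapping.single (rev ps) 1 \<in> light (wt ps)"
      using alg_act_admissible[of n ps, where 'k = 'k] adm ps by (simp add: has_leading_word_def X_def wt_def)
    then have "rev qs \<notin> Poly_Mapping.keys (X ps - Poly_Mapping.single (rev ps) 1)"
      using le[OF ps False] by (auto simp: light_def supported_def wt_def)
    then have "Poly_Mapping.lookup (X ps) (rev qs) = Poly_Mapping.lookup (Poly_Mapping.single (rev ps) (1 :: 'k)) (rev qs)"
      by (simp add: in_keys_iff lookup_minus)
    then show ?thesis
      by (auto simp: lookup_single when_def)
  qed (use qs in auto)
  ultimately have "(\<Sum>ps\<in>P. if ps = qs then a qs else 0) = 0"
    by simp
  then show False
    using qs fin by simp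
qed

theorem theorem1p3p3:
  fixes n :: nat
  assumes "n \<ge> 1"
  shows "vectorspace.basis (class_ring :: 'k::field ring) (Q_alg n) (basis_products n)"
proof -
  let ?Q = "Q_alg n :: ('k, _) module" and ?B = "basis_products n :: (_ \<Rightarrow>\<^sub>0 'k) set set"
  interpret Q: vectorspace "class_ring :: 'k ring" ?Q
    by (rule vectorspace_Q_alg)
  have prod_carrier: "r_prod (flatten ps) \<in> (free_carrier n :: (_ \<Rightarrow>\<^sub>0 'k) set)" if "admissible n ps" for ps
    using flatten_subset[OF that] by (intro r_prod_carrier) blast
  have B: "?B \<subseteq> carrier ?Q"
    unfolding basis_products_eq_coset_of using prod_carrier coset_of_closed by blast
  have "Q.lin_indpt ?B"
  proof
    assume "Q.lin_dep ?B"
    then obtain S a v where S: "finite S" "S \<subseteq> ?B" "Q.lincomb a S = \<zero>\<^bsub>?Q\<^esub>" and v: "v \<in> S" "a v \<noteq> 0"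
      unfolding Q.lin_dep_def by auto
    have "\<forall>x\<in>S. \<exists>ps. x = coset_of n (r_prod (flatten ps)) \<and> admissible n ps"
      using S(2) unfolding basis_products_eq_coset_of by blast
    then obtain f where f: "\<And>x. x \<in> S \<Longrightarrow> x = coset_of n (r_prod (flatten (f x)))" "\<And>x. x \<in> S \<Longrightarrow> admissible n (f x)"
      by metis
    then have inj: "inj_on f S" by (metis inj_onI)
    have sum_carrier: "(\<Sum>x\<in>T. scal (a x) (r_prod (flatten (f x)))) \<in> free_carrier n" if "T \<subseteq> S" for T
      using that f(2) prod_carrier by (intro supported_sum supported_scal) auto
    have "Q.lincomb a T = coset_of n (\<Sum>x\<in>T. scal (a x) (r_prod (flatten (f x))))" if "finite T" "T \<subseteq> S" for T
      using that
    proof (induction T)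
      case empty
      show ?case by (simp add: Q.lincomb_def coset_of_zero)
    next
      case (insert x T)
      have T: "T \<subseteq> carrier ?Q" "x \<in> carrier ?Q"
        using insert.prems S(2) B by auto
      have x: "x = coset_of n (r_prod (flatten (f x)))" "r_prod (flatten (f x)) \<in> (free_carrier n :: (_ \<Rightarrow>\<^sub>0 'k) set)"
        using insert.prems f prod_carrier by auto
      have "Q.lincomb a (insert x T) = a x \<odot>\<^bsub>?Q\<^esub> x \<oplus>\<^bsub>?Q\<^esub> Q.lincomb a T"
        using insert.hyps T by (intro Q.lincomb_insert2) auto
      also have "a x \<odot>\<^bsub>?Q\<^esub> x = coset_of n (scal (a x) (r_prod (flatten (f x))))"
        by (subst x(1)) (rule coset_of_smult[OF x(2)])
      also have "Q.lincomb a T = coset_of n (\<Sum>x\<in>T. scal (a x) (r_prod (flatten (f x))))"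
        using insert by auto
      also have "coset_of n (scal (a x) (r_prod (flatten (f x)))) \<oplus>\<^bsub>?Q\<^esub> coset_of n (\<Sum>x\<in>T. scal (a x) (r_prod (flatten (f x))))
          = coset_of n (\<Sum>x\<in>insert x T. scal (a x) (r_prod (flatten (f x))))"
        using insert x(2) sum_carrier[of T] by (simp add: coset_of_add supported_scal)
      finally show ?case .
    qed
    from this[OF S(1) order.refl] S(3)
    have "coset_of n (\<Sum>x\<in>S. scal (a x) (r_prod (flatten (f x)))) = coset_of n 0"
      by (simp add: coset_of_zero)
    then have "(\<Sum>x\<in>S. scal (a x) (r_prod (flatten (f x)))) \<in> rel_ideal n"
      using sum_carrier[of S] by (simp add: coset_of_eq_iff)
    also have "(\<Sum>x\<in>S. scal (a x) (r_prod (flatten (f x))))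
        = (\<Sum>ps\<in>f ` S. scal (a (the_inv_into S f ps)) (r_prod (flatten ps)))"
      by (simp add: sum.reindex[OF inj] the_inv_into_f_f[OF inj])
    finally have "\<forall>ps\<in>f ` S. a (the_inv_into S f ps) = 0"
      using S(1) f(2) by (intro admissible_independent) auto
    then show False
      using v by (simp add: the_inv_into_f_f[OF inj])
  qed
  moreover have "Q.gen_set ?B"
  proof
    show "Q.span ?B \<subseteq> carrier ?Q"
      by (rule Q.span_is_subset2[OF B])
    have sub: "submodule class_ring (Q.span ?B) ?Q"
      by (rule Q.span_is_submodule[OF B])
    let ?T = "{p \<in> free_carrier n. coset_of n p \<in> Q.span ?B}"
    have "free_carrier n \<subseteq> words.span ({r_prod (flatten ps) | ps. admissible n ps} \<union> (rel_ideal n :: (_ \<Rightarrow>\<^sub>0 'k) set))"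
      by (rule free_carrier_spanned)
    also have "\<dots> \<subseteq> ?T"
    proof (rule words.span_minimal)
      have zero: "coset_of n (0 :: _ \<Rightarrow>\<^sub>0 'k) \<in> Q.span ?B"
        unfolding coset_of_zero[symmetric] using Q.span_zero by simp
      show "words.subspace ?T"
        using sub zero unfolding submodule_def
        by (intro words.subspaceI) (auto simp: supported_add supported_scal simp flip: coset_of_add coset_of_smult)
      have "coset_of n p = coset_of n 0" if "p \<in> rel_ideal n" for p :: "_ \<Rightarrow>\<^sub>0 'k"
        using that rel_ideal_carrier[OF that] by (simp add: coset_of_eq_iff)
      then show "{r_prod (flatten ps) | ps. admissible n ps} \<union> rel_ideal n \<subseteq> ?T"
        using zero prod_carrier rel_ideal_carrier Q.in_own_span[OF B] basis_products_eq_coset_of[of n, where 'k = 'k]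
        by auto
    qed
    finally show "carrier ?Q \<subseteq> Q.span ?B"
      by (auto simp: coset_of_carrier)
  qed
  ultimately show ?thesis
    unfolding Q.basis_def using B by blast
qed

end
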